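(* If $f$ is the functor $\mathbf\Omega\to\mathbf U_{\mathrm{cyc}}$ that forgets about the directed structure, then the left Kan extension functor $f_!\colon\widehat{\mathbf\Omega}\to\widehat{\mathbf U_{\mathrm{cyc}}}$ takes Segal objects to Segal objects.
   Context: $\widehat{\mathbf C}=\mathrm{Fun}(\mathbf C^{\mathrm{op}},\mathbf{Set})$; $f_!$ is the left adjoint of the restriction $f^*$. **Graphs.** A graph $G$ consists of finite sets $A_G$ (arcs) and $V_G$ (vertices), a fixpoint-free involution $a\mapsto a^\dagger$ on $A_G$, a subset $D_G\subseteq A_G$, and a function $t\colon D_G\to V_G$. For $v\in V_G$, $\mathrm{nb}(v)=t^{-1}(v)$; the boundary is $\partial(G)=A_G\setminus D_G$; edges are $\dagger$-orbits $[a,a^\dagger]$, and an edge is internal if $a,a^\dagger\in D_G$. Connected means non-empty and not a disjoint union of two non-empty graphs. The edge graph $\updownarrow$ has two arcs interchanged by $\dagger$ and $D=V=\varnothing$; the $n$-star $\star_n$ ($n\ge0$) has one vertex, $D=\{1,\dots,n\}$, $A=\{1,1^\dagger,\dots,n,n^\dagger\}$. A tree is a connected graph that is simply connected (contains no cycles); equivalently, a connected graph with $V_G=\varnothing$, or with exactly $|V_G|-1$ internal edges. An étale map $f\colon H\to G$ consists of functions on $A$, $D$, $V$ compatible with all structure, restricting to bijections $\mathrm{nb}(v)\to\mathrm{nb}(f(v))$. An embedding is an étale map between connected graphs, injective on vertices. $\mathrm{Emb}(G)$ is the set of classes $[f]$ of embeddings with codomain $G$ ($f\sim h$ iff $f=hz$,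 $z$ an isomorphism); $[f\colon H\to G]$ is an edge if $H\cong\updownarrow$; $\varsigma[f]=f(V_H)$, $\partial([f])=f(\partial(H))$. For $v\in V_G$, $\iota_v\colon\star_v\to G$ is the canonical embedding, with $\star_v$ having vertex set $\{v\}$, $D_{\star_v}=\mathrm{nb}(v)$, arc set $\mathrm{nb}(v)\amalg\{b_d\}_{d\in\mathrm{nb}(v)}$, $d^\dagger=b_d$, $\iota_v(d)=d$, $\iota_v(b_d)=d^\dagger$. **Graphical maps.** A graphical map $\varphi\colon G\to G'$ between connected graphs is a pair of an involutive function $\varphi_0\colon A_G\to A_{G'}$ and a function $\varphi_1\colon V_G\to\mathrm{Emb}(G')$ such that: (a) the sets $\varsigma(\varphi_1(v))$ are pairwise disjoint; (b) for each $v$, $a\mapsto\varphi_0(a^\dagger)$ gives a bijection $\mathrm{nb}(v)\to\partial(\varphi_1(v))$; (c) if $\partial(G)=\varnothing$, there is $v$ with $\varphi_1(v)$ not an edge. The composite with $\psi\colon G'\to G''$ has $(\psi\varphi)_0=\psi_0\varphi_0$, and $(\psi\varphi)_1(v)$ is the unique class in $\mathrm{Emb}(G'')$ with boundary $\psi_0(\partial(\varphi_1(v)))$ and vertex set $\coprod_{w\in\varsigma(\varphi_1(v))}\varsigma(\psi_1(w))$. An embedding $f\colon H\to G$ is regarded as the graphical map given by $f$ on arcs and $v\mapsto[\iota_{f(v)}]$; these are the inert maps. **$\mathbf U_{\mathrm{cyc}}$ and $\mathbf\Omega$.** $\mathbf U_{\mathrm{cyc}}$ has objects the trees with non-empty boundary,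 and morphisms all graphical maps between them. The (Moerdijk–Weiss) dendroidal category $\mathbf\Omega$ has as objects pairs $(T,x)$ where $T$ is a tree and $x\colon A_T\to\{+1,-1\}$ satisfies $x(a^\dagger)=-x(a)$, such that $\mathrm{out}(v)=\{d\in\mathrm{nb}(v):x_d=+1\}$ is a singleton for every $v\in V_T$ (i.e. rooted trees; the set $\{a\in\partial(T):x_a=-1\}$ of outputs of $T$ is then a singleton). Morphisms $(T,x)\to(T',x')$ are the graphical maps $\varphi\colon T\to T'$ with $x'\varphi_0=x$; such a map is inert if the underlying graphical map is. The functor $f$ forgets $x$. **Segal presheaves.** Let $\mathbf C$ be $\mathbf\Omega$ or $\mathbf U_{\mathrm{cyc}}$. An object is elementary if its underlying undirected graph is isomorphic to $\updownarrow$ or to some $\star_n$. $\mathbf C^{\mathrm{el}}_{/c}$ is the category of inert maps $w\to c$ in $\mathbf C$ with $w$ elementary, and (inert) maps over $c$. $Z\in\widehat{\mathbf C}$ is Segal if for every $c\in\mathbf C$ the canonical map $Z_c\to\lim_{(w\to c)\in(\mathbf C^{\mathrm{el}}_{/c})^{\mathrm{op}}}Z_w$ is a bijection. *)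

theory Defs
  imports "HOL-Library.FuncSet" "HOL-Library.Disjoint_Sets"
begin

text \<open>
  Set-theoretic functions are rendered throughout as extensional functions
  (\<^term>\<open>A \<rightarrow>\<^sub>E B\<close>), so that equality of HOL functions is equality of maps.
\<close>

section \<open>Graphs\<close>

record ('a, 'v) graph =
  arcs :: "'a set"
  verts :: "'v set"
  dag :: "'a \<Rightarrow> 'a"
  darcs :: "'a set"
  tgt :: "'a \<Rightarrow> 'v"

definition graph :: "('a, 'v) graph \<Rightarrow> bool" where
  "graph G \<longleftrightarrow>
     finite (arcs G) \<and> finite (verts G) \<and>
     dag G \<in> arcs G \<rightarrow>\<^sub>E arcs G \<and>
     (\<forall>a\<in>arcs G. dag G (dag G a) = a \<and> dag G a \<noteq> a) \<and>
     darcs G \<subseteq> arcs G \<and>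
     tgt G \<in> darcs G \<rightarrow>\<^sub>E verts G"

definition nb :: "('a, 'v) graph \<Rightarrow> 'v \<Rightarrow> 'a set" where
  "nb G v = {d \<in> darcs G. tgt G d = v}"

definition boundary :: "('a, 'v) graph \<Rightarrow> 'a set" where
  "boundary G = arcs G - darcs G"

text \<open>\<open>splits G A1 V1 A2 V2\<close>: \<open>G\<close> is the disjoint union of the two non-empty graphs
  with arc sets \<open>A1\<close>, \<open>A2\<close> and vertex sets \<open>V1\<close>, \<open>V2\<close>.\<close>

definition splits ::
  "('a, 'v) graph \<Rightarrow> 'a set \<Rightarrow> 'v set \<Rightarrow> 'a set \<Rightarrow> 'v set \<Rightarrow> bool" where
  "splits G A1 V1 A2 V2 \<longleftrightarrow>
     arcs G = A1 \<union> A2 \<and> A1 \<inter> A2 = {} \<and> verts G = V1 \<union> V2 \<and> V1 \<inter> V2 = {} \<and>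
     dag G ` A1 \<subseteq> A1 \<and> dag G ` A2 \<subseteq> A2 \<and>
     tgt G ` (darcs G \<inter> A1) \<subseteq> V1 \<and> tgt G ` (darcs G \<inter> A2) \<subseteq> V2 \<and>
     (A1 \<noteq> {} \<or> V1 \<noteq> {}) \<and> (A2 \<noteq> {} \<or> V2 \<noteq> {})"

definition connected_graph :: "('a, 'v) graph \<Rightarrow> bool" where
  "connected_graph G \<longleftrightarrow>
     graph G \<and> (arcs G \<noteq> {} \<or> verts G \<noteq> {}) \<and> (\<nexists>A1 V1 A2 V2. splits G A1 V1 A2 V2)"

text \<open>A cycle is recorded by its arcs \<open>a\<^sub>0, \<dots>, a\<^sub>n\<^sub>-\<^sub>1\<close> (with \<open>n \<ge> 1\<close>), oriented so that
  \<open>a\<^sub>i\<close> runs from the vertex \<open>t(a\<^sub>i\<^sup>\<dagger>)\<close> to the vertex \<open>t(a\<^sub>i)\<close>; indices are taken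
  modulo \<open>n\<close>. Loops (\<open>n = 1\<close>) and pairs of parallel edges (\<open>n = 2\<close>) are cycles.
  The condition \<open>a\<^sub>i\<^sub>+\<^sub>1 \<noteq> a\<^sub>i\<^sup>\<dagger>\<close> only matters for \<open>n = 2\<close>, where it forbids going back and
  forth along one edge.\<close>

definition is_cycle :: "('a, 'v) graph \<Rightarrow> 'a list \<Rightarrow> bool" where
  "is_cycle G as \<longleftrightarrow>
     as \<noteq> [] \<and>
     (\<forall>a\<in>set as. a \<in> darcs G \<and> dag G a \<in> darcs G) \<and>
     (\<forall>i<length as.
        tgt G (dag G (as ! (Suc i mod length as))) = tgt G (as ! i) \<and>
        as ! (Suc i mod length as) \<noteq> dag G (as ! i)) \<and>
     distinct (map (tgt G) as)"

definition tree :: "('a, 'v) graph \<Rightarrow> bool" where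
  "tree G \<longleftrightarrow> connected_graph G \<and> (\<nexists>as. is_cycle G as)"

definition edge_graph :: "(bool, unit) graph" where
  "edge_graph = \<lparr>arcs = UNIV, verts = {}, dag = Not, darcs = {}, tgt = (\<lambda>_. undefined)\<rparr>"

text \<open>The star with vertex \<open>v\<close> and neighbourhood \<open>N\<close>; \<^term>\<open>Inr d\<close> is the arc
  \<open>b\<^sub>d = d\<^sup>\<dagger>\<close>.\<close>

definition star_on :: "'d set \<Rightarrow> 'v \<Rightarrow> ('d + 'd, 'v) graph" where
  "star_on N v =
     \<lparr>arcs = N <+> N, verts = {v},
      dag = restrict (case_sum Inr Inl) (N <+> N),
      darcs = Inl ` N, tgt = restrict (\<lambda>_. v) (Inl ` N)\<rparr>"

definition star :: "nat \<Rightarrow> (nat + nat, unit) graph" where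
  "star n = star_on {1..n} ()"

section \<open>Etale maps and embeddings\<close>

text \<open>The component of an etale map on the sets \<open>D\<close> is the restriction of its component on arcs.\<close>

record ('a, 'v, 'b, 'w) gmap =
  amap :: "'a \<Rightarrow> 'b"
  vmap :: "'v \<Rightarrow> 'w"

definition etale ::
  "('a, 'v) graph \<Rightarrow> ('b, 'w) graph \<Rightarrow> ('a, 'v, 'b, 'w) gmap \<Rightarrow> bool" where
  "etale H G f \<longleftrightarrow>
     graph H \<and> graph G \<and>
     amap f \<in> arcs H \<rightarrow>\<^sub>E arcs G \<and> vmap f \<in> verts H \<rightarrow>\<^sub>E verts G \<and>
     (\<forall>a\<in>arcs H. amap f (dag H a) = dag G (amap f a)) \<and>
     (\<forall>d\<in>darcs H. amap f d \<in> darcs G \<and> tgt G (amap f d) = vmap f (tgt H d)) \<and>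
     (\<forall>v\<in>verts H. bij_betw (amap f) (nb H v) (nb G (vmap f v)))"

definition graph_iso ::
  "('a, 'v) graph \<Rightarrow> ('b, 'w) graph \<Rightarrow> ('a, 'v, 'b, 'w) gmap \<Rightarrow> bool" where
  "graph_iso H G z \<longleftrightarrow>
     etale H G z \<and> bij_betw (amap z) (arcs H) (arcs G) \<and>
     bij_betw (amap z) (darcs H) (darcs G) \<and> bij_betw (vmap z) (verts H) (verts G)"

definition isomorphic :: "('a, 'v) graph \<Rightarrow> ('b, 'w) graph \<Rightarrow> bool" where
  "isomorphic H G \<longleftrightarrow> (\<exists>z. graph_iso H G z)"

definition gmap_comp ::
  "('a, 'v) graph \<Rightarrow> ('b, 'w, 'c, 'u) gmap \<Rightarrow> ('a, 'v, 'b, 'w) gmap \<Rightarrow> ('a, 'v, 'c, 'u) gmap"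
where
  "gmap_comp K g f =
     \<lparr>amap = compose (arcs K) (amap g) (amap f), vmap = compose (verts K) (vmap g) (vmap f)\<rparr>"

definition gmap_id :: "('a, 'v) graph \<Rightarrow> ('a, 'v, 'a, 'v) gmap" where
  "gmap_id G = \<lparr>amap = restrict id (arcs G), vmap = restrict id (verts G)\<rparr>"

definition embedding ::
  "('a, 'v) graph \<Rightarrow> ('b, 'w) graph \<Rightarrow> ('a, 'v, 'b, 'w) gmap \<Rightarrow> bool" where
  "embedding H G f \<longleftrightarrow>
     connected_graph H \<and> connected_graph G \<and> etale H G f \<and> inj_on (vmap f) (verts H)"

text \<open>The categories below are built from graphs whose arcs and vertices are natural numbers;
  every finite graph is isomorphic to one of these. A class of embeddings into \<open>G\<close> is the set of
  all its representatives with such domains; the embedding \<open>f\<close> naming the class may have a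
  domain over other types.\<close>

type_synonym ngraph = "(nat, nat) graph"

type_synonym emb = "(ngraph \<times> (nat, nat, nat, nat) gmap) set"

definition emb_class :: "('a, 'v) graph \<Rightarrow> ('a, 'v, nat, nat) gmap \<Rightarrow> emb" where
  "emb_class H f = {(K, g). \<exists>z. graph_iso K H z \<and> g = gmap_comp K f z}"

definition Emb :: "ngraph \<Rightarrow> emb set" where
  "Emb G = {emb_class H f | (H :: ngraph) f. embedding H G f}"

definition emb_is_edge :: "emb \<Rightarrow> bool" where
  "emb_is_edge e \<longleftrightarrow> (\<exists>(K, g)\<in>e. isomorphic K edge_graph)"

text \<open>The images of the vertex set and of the boundary do not depend on the representative, so
  the unions below are unions of equal sets.\<close>

definition emb_verts :: "emb \<Rightarrow> nat set" where
  "emb_verts e = (\<Union>(K, g)\<in>e. vmap g ` verts K)"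

definition emb_boundary :: "emb \<Rightarrow> nat set" where
  "emb_boundary e = (\<Union>(K, g)\<in>e. amap g ` boundary K)"

definition iota :: "('a, 'v) graph \<Rightarrow> 'v \<Rightarrow> ('a + 'a, 'v, 'a, 'v) gmap" where
  "iota G v =
     \<lparr>amap = restrict (case_sum id (dag G)) (nb G v <+> nb G v), vmap = restrict id {v}\<rparr>"

definition vertex_class :: "ngraph \<Rightarrow> nat \<Rightarrow> emb" where
  "vertex_class G v = emb_class (star_on (nb G v) v) (iota G v)"

section \<open>Graphical maps\<close>

record graphical =
  garc :: "nat \<Rightarrow> nat"
  gvert :: "nat \<Rightarrow> emb"

definition graphical_map :: "ngraph \<Rightarrow> ngraph \<Rightarrow> graphical \<Rightarrow> bool" where
  "graphical_map G G' \<phi> \<longleftrightarrow>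
     connected_graph G \<and> connected_graph G' \<and>
     garc \<phi> \<in> arcs G \<rightarrow>\<^sub>E arcs G' \<and>
     (\<forall>a\<in>arcs G. garc \<phi> (dag G a) = dag G' (garc \<phi> a)) \<and>
     gvert \<phi> \<in> verts G \<rightarrow>\<^sub>E Emb G' \<and>
     disjoint_family_on (\<lambda>v. emb_verts (gvert \<phi> v)) (verts G) \<and>
     (\<forall>v\<in>verts G.
        bij_betw (\<lambda>a. garc \<phi> (dag G a)) (nb G v) (emb_boundary (gvert \<phi> v))) \<and>
     (boundary G = {} \<longrightarrow> (\<exists>v\<in>verts G. \<not> emb_is_edge (gvert \<phi> v)))"

text \<open>The composite of \<open>\<phi> : G \<rightarrow> G'\<close> and \<open>\<psi> : G' \<rightarrow> G''\<close>.\<close>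

definition graphical_comp ::
  "ngraph \<Rightarrow> ngraph \<Rightarrow> ngraph \<Rightarrow> graphical \<Rightarrow> graphical \<Rightarrow> graphical" where
  "graphical_comp G G' G'' \<psi> \<phi> =
     \<lparr>garc = compose (arcs G) (garc \<psi>) (garc \<phi>),
      gvert = (\<lambda>v\<in>verts G. THE e. e \<in> Emb G'' \<and>
                 emb_boundary e = garc \<psi> ` emb_boundary (gvert \<phi> v) \<and>
                 emb_verts e = (\<Union>w\<in>emb_verts (gvert \<phi> v). emb_verts (gvert \<psi> w)))\<rparr>"

definition graphical_of_embedding ::
  "ngraph \<Rightarrow> ngraph \<Rightarrow> (nat, nat, nat, nat) gmap \<Rightarrow> graphical" where
  "graphical_of_embedding H G f =
     \<lparr>garc = amap f, gvert = (\<lambda>v\<in>verts H. vertex_class G (vmap f v))\<rparr>"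

definition graphical_id :: "ngraph \<Rightarrow> graphical" where
  "graphical_id G = graphical_of_embedding G G (gmap_id G)"

definition inert_map :: "ngraph \<Rightarrow> ngraph \<Rightarrow> graphical \<Rightarrow> bool" where
  "inert_map H G \<phi> \<longleftrightarrow> (\<exists>f. embedding H G f \<and> \<phi> = graphical_of_embedding H G f)"

definition elementary_graph :: "ngraph \<Rightarrow> bool" where
  "elementary_graph G \<longleftrightarrow> isomorphic G edge_graph \<or> (\<exists>n. isomorphic G (star n))"

section \<open>Categories, presheaves and left Kan extensions\<close>

text \<open>In \<open>cmp C a b c g f\<close> the arrows are \<open>f : a \<rightarrow> b\<close> and \<open>g : b \<rightarrow> c\<close>.\<close>

record ('o, 'm) cat =
  ob :: "'o set"
  hom :: "'o \<Rightarrow> 'o \<Rightarrow> 'm set"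
  ident :: "'o \<Rightarrow> 'm"
  cmp :: "'o \<Rightarrow> 'o \<Rightarrow> 'o \<Rightarrow> 'm \<Rightarrow> 'm \<Rightarrow> 'm"

record ('o, 'm) el_cat = "('o, 'm) cat" +
  elem :: "'o set"
  inert :: "'o \<Rightarrow> 'o \<Rightarrow> 'm set"

record ('o, 'm, 'p, 'n) cfunctor =
  fob :: "'o \<Rightarrow> 'p"
  fhom :: "'o \<Rightarrow> 'o \<Rightarrow> 'm \<Rightarrow> 'n"

text \<open>For \<open>f : c \<rightarrow> d\<close>, \<open>pact Z c d f\<close> is the restriction map \<open>Z\<^sub>d \<rightarrow> Z\<^sub>c\<close>. Presheaves take
  values in the subsets of a type \<open>'s\<close>.\<close>

record ('o, 'm, 's) psh =
  pob :: "'o \<Rightarrow> 's set"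
  pact :: "'o \<Rightarrow> 'o \<Rightarrow> 'm \<Rightarrow> 's \<Rightarrow> 's"

definition presheaf :: "('o, 'm, 'x) cat_scheme \<Rightarrow> ('o, 'm, 's) psh \<Rightarrow> bool" where
  "presheaf C Z \<longleftrightarrow>
     (\<forall>c\<in>ob C. \<forall>d\<in>ob C. \<forall>f\<in>hom C c d. pact Z c d f \<in> pob Z d \<rightarrow> pob Z c) \<and>
     (\<forall>c\<in>ob C. \<forall>z\<in>pob Z c. pact Z c c (ident C c) z = z) \<and>
     (\<forall>b\<in>ob C. \<forall>c\<in>ob C. \<forall>d\<in>ob C. \<forall>f\<in>hom C b c. \<forall>g\<in>hom C c d. \<forall>z\<in>pob Z d.
        pact Z b d (cmp C b c d g f) z = pact Z b c f (pact Z c d g z))"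

definition nat_trans ::
  "('o, 'm, 'x) cat_scheme \<Rightarrow> ('o, 'm, 's) psh \<Rightarrow> ('o, 'm, 's) psh \<Rightarrow> ('o \<Rightarrow> 's \<Rightarrow> 's) \<Rightarrow> bool"
where
  "nat_trans C X Y \<alpha> \<longleftrightarrow>
     \<alpha> \<in> (\<Pi>\<^sub>E c\<in>ob C. pob X c \<rightarrow>\<^sub>E pob Y c) \<and>
     (\<forall>c\<in>ob C. \<forall>d\<in>ob C. \<forall>f\<in>hom C c d. \<forall>x\<in>pob X d.
        \<alpha> c (pact X c d f x) = pact Y c d f (\<alpha> d x))"

definition restriction ::
  "('o, 'm, 'p, 'n) cfunctor \<Rightarrow> ('p, 'n, 's) psh \<Rightarrow> ('o, 'm, 's) psh" where
  "restriction F Z =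
     \<lparr>pob = (\<lambda>c. pob Z (fob F c)),
      pact = (\<lambda>c d f. pact Z (fob F c) (fob F d) (fhom F c d f))\<rparr>"

text \<open>\<open>(Y, \<eta>)\<close> is a universal arrow from \<open>X\<close> to the restriction functor \<open>F\<^sup>*\<close>, that is, \<open>Y\<close> is
  the value at \<open>X\<close> of the left adjoint \<open>F\<^sub>!\<close> of \<open>F\<^sup>*\<close> and \<open>\<eta>\<close> is the unit at \<open>X\<close>. All presheaves
  here have values in subsets of one type \<open>'s\<close>; when \<open>'s\<close> is infinite and at least as large
  as the categories involved, such a \<open>Y\<close> is also left adjoint against presheaves with values in
  larger sets, since the colimits computing it do not leave this size.\<close>

definition left_Kan_extension ::
  "('o, 'm, 'x) cat_scheme \<Rightarrow> ('p, 'n, 'y) cat_scheme \<Rightarrow> ('o, 'm, 'p, 'n) cfunctor \<Rightarrow>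
   ('o, 'm, 's) psh \<Rightarrow> ('p, 'n, 's) psh \<Rightarrow> ('o \<Rightarrow> 's \<Rightarrow> 's) \<Rightarrow> bool" where
  "left_Kan_extension C D F X Y \<eta> \<longleftrightarrow>
     presheaf C X \<and> presheaf D Y \<and> nat_trans C X (restriction F Y) \<eta> \<and>
     (\<forall>Z \<alpha>. presheaf D Z \<and> nat_trans C X (restriction F Z) \<alpha> \<longrightarrow>
        (\<exists>!\<beta>. nat_trans D Y Z \<beta> \<and>
              \<alpha> = (\<lambda>c\<in>ob C. compose (pob X c) (\<beta> (fob F c)) (\<eta> c))))"

section \<open>Segal presheaves\<close>

definition el_over :: "('o, 'm) el_cat \<Rightarrow> 'o \<Rightarrow> ('o \<times> 'm) set" where
  "el_over C c = {(w, i). w \<in> elem C \<and> i \<in> inert C w c}"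

definition el_limit :: "('o, 'm) el_cat \<Rightarrow> ('o, 'm, 's) psh \<Rightarrow> 'o \<Rightarrow> ('o \<times> 'm \<Rightarrow> 's) set" where
  "el_limit C Z c =
     {s \<in> (\<Pi>\<^sub>E (w, i)\<in>el_over C c. pob Z w).
        \<forall>(w, i)\<in>el_over C c. \<forall>(w', i')\<in>el_over C c. \<forall>h\<in>inert C w w'.
          cmp C w w' c i' h = i \<longrightarrow> pact Z w w' h (s (w', i')) = s (w, i)}"

definition segal :: "('o, 'm) el_cat \<Rightarrow> ('o, 'm, 's) psh \<Rightarrow> bool" where
  "segal C Z \<longleftrightarrow>
     presheaf C Z \<and>
     (\<forall>c\<in>ob C.
        bij_betw (\<lambda>z. \<lambda>(w, i)\<in>el_over C c. pact Z w c i z) (pob Z c) (el_limit C Z c))"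

section \<open>The categories \<open>U_cyc\<close> and \<open>Omega\<close>\<close>

definition U_cyc :: "(ngraph, graphical) el_cat" where
  "U_cyc =
     \<lparr>ob = {T. tree T \<and> boundary T \<noteq> {}},
      hom = (\<lambda>T T'. {\<phi>. graphical_map T T' \<phi>}),
      ident = graphical_id,
      cmp = graphical_comp,
      elem = {T. tree T \<and> boundary T \<noteq> {} \<and> elementary_graph T},
      inert = (\<lambda>T T'. {\<phi>. graphical_map T T' \<phi> \<and> inert_map T T' \<phi>})\<rparr>"

definition rooted_tree :: "ngraph \<times> (nat \<Rightarrow> int) \<Rightarrow> bool" where
  "rooted_tree = (\<lambda>(T, x).
     tree T \<and> x \<in> arcs T \<rightarrow>\<^sub>E {1, -1} \<and> (\<forall>a\<in>arcs T. x (dag T a) = - x a) \<and>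
     (\<forall>v\<in>verts T. \<exists>!d. d \<in> nb T v \<and> x d = 1))"

definition Omega_hom ::
  "ngraph \<times> (nat \<Rightarrow> int) \<Rightarrow> ngraph \<times> (nat \<Rightarrow> int) \<Rightarrow> graphical set" where
  "Omega_hom = (\<lambda>(T, x) (T', x').
     {\<phi>. graphical_map T T' \<phi> \<and> (\<forall>a\<in>arcs T. x' (garc \<phi> a) = x a)})"

definition Omega :: "(ngraph \<times> (nat \<Rightarrow> int), graphical) el_cat" where
  "Omega =
     \<lparr>ob = {S. rooted_tree S},
      hom = Omega_hom,
      ident = (\<lambda>S. graphical_id (fst S)),
      cmp = (\<lambda>S S' S''. graphical_comp (fst S) (fst S') (fst S'')),
      elem = {S. rooted_tree S \<and> elementary_graph (fst S)},
      inert = (\<lambda>S S'. {\<phi> \<in> Omega_hom S S'. inert_map (fst S) (fst S') \<phi>})\<rparr>"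

definition forget ::
  "(ngraph \<times> (nat \<Rightarrow> int), graphical, ngraph, graphical) cfunctor" where
  "forget = \<lparr>fob = fst, fhom = (\<lambda>S S' \<phi>. \<phi>)\<rparr>"

end

(*
  A graphical map T -> T' sends a vertex v to a subtree of T' whose boundary is in bijection
  with nb(v). As a rooted tree has exactly one root, every rooting of T' restricts to a rooting of
  T, so the forgetful functor is a discrete fibration and f_! X (T) is the disjoint union of
  X(T, x) over the rootings x of T. A rooting can be specified compatibly on the edges and stars
  of T, and once x is fixed the elementary objects over (T, x) and over T are the same; hence the
  Segal condition for f_! X reduces to the one for X.
*)

theory Submission
  imports Defs "HOL-Library.Countable_Set"
begin

section \<open>The root of a rooted tree\<close>

text \<open>A root exists because following outputs in a finite acyclic graph must stop; it is
  unique because the edges draining to one root form, with their vertices, a union of components.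
  The output of a vertex has sign +1 as an arc ending there, whereas the root is a boundary arc of
  sign -1: the dagger in the boundary bijection \<open>\<lambda>a. garc \<phi> (dag T a)\<close> of
  a graphical map turns one into the other.

  The Kan extension is given only by a universal property among presheaves with values in a single
  type. The disjoint union is therefore characterised up to isomorphism by
  \<open>fibrewise_extension\<close>, realised once by coding pairs (rooting, element) into an
  infinite type, and carried to every other Kan extension by uniqueness.

  Rootings glue since the conditions defining them concern one edge or one neighbourhood at a time.
  The test objects must however lie in \<open>U_cyc\<close>: edges and stars are rebuilt on natural
  numbers, and the 0-star, whose boundary is empty, must be seen not to occur.\<close>

lemma graphD:
  assumes "graph G"
  shows "finite (arcs G)" "finite (verts G)" "\<And>a. a \<in> arcs G \<Longrightarrow> dag G a \<in> arcs G"
    "\<And>a. a \<in> arcs G \<Longrightarrow> dag G (dag G a) = a" "\<And>a. a \<in> arcs G \<Longrightarrow> dag G a \<noteq> a"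
    "\<And>d. d \<in> darcs G \<Longrightarrow> d \<in> arcs G" "\<And>d. d \<in> darcs G \<Longrightarrow> tgt G d \<in> verts G"
  using assms unfolding graph_def by (auto simp: PiE_iff)

text \<open>The period is minimised over all points of \<open>V\<close> at once: a coincidence
  inside the orbit of \<open>u\<close> would make \<open>(f ^^ i) u\<close> a point of the smaller
  period \<open>j - i\<close>.\<close>

lemma finite_self_map_minimal_period:
  assumes "finite V" "V \<noteq> {}" "f ` V \<subseteq> V"
  obtains n u where "n > 0" "u \<in> V" "(f ^^ n) u = u" "inj_on (\<lambda>i. (f ^^ i) u) {..<n}"
proof -
  have in_V: "(f ^^ i) u \<in> V" if "u \<in> V" for i u
    using that assms(3) by (induction i) auto
  define P where "P n \<longleftrightarrow> n > 0 \<and> (\<exists>u\<in>V. (f ^^ n) u = u)" for n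
  have repeat: "\<exists>u\<in>V. (f ^^ (j - i)) u = u" if "i < j" "v \<in> V" "(f ^^ i) v = (f ^^ j) v" for i j v
  proof -
    have "(f ^^ (j - i)) ((f ^^ i) v) = (f ^^ j) v"
      using that(1) funpow_add[of "j - i" i f] by simp
    then show ?thesis using that in_V by metis
  qed
  obtain v where v: "v \<in> V" using assms(2) by blast
  have "\<not> inj_on (\<lambda>i. (f ^^ i) v) UNIV"
    using in_V[OF v] assms(1) by (metis finite_imageD finite_subset image_subsetI infinite_UNIV_nat)
  then obtain i j where "i < j" "(f ^^ i) v = (f ^^ j) v"
    unfolding inj_on_def by (metis linorder_neqE_nat)
  then have "P (j - i)" using repeat v by (auto simp: P_def)
  define n where "n = (LEAST n. P n)"
  have "P n" unfolding n_def by (rule LeastI, fact)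
  then obtain u where u: "n > 0" "u \<in> V" "(f ^^ n) u = u" by (auto simp: P_def)
  have "inj_on (\<lambda>i. (f ^^ i) u) {..<n}"
  proof (rule linorder_inj_onI)
    fix i j assume ij: "i < j" "i \<in> {..<n}" "j \<in> {..<n}"
    show "(f ^^ i) u \<noteq> (f ^^ j) u"
    proof
      assume "(f ^^ i) u = (f ^^ j) u"
      then have "P (j - i)" using repeat ij u(2) by (auto simp: P_def)
      then have "n \<le> j - i" unfolding n_def by (rule Least_le)
      then show False using ij by auto
    qed
  qed auto
  then show thesis using u that by blast
qed

text \<open>Following the chosen arcs from vertex to vertex in a finite graph must close up.\<close>

lemma cycle_of_non_backtracking_choice:
  assumes G: "graph G" and ne: "verts G \<noteq> {}"
    and out: "\<And>v. v \<in> verts G \<Longrightarrow> out v \<in> nb G v"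
    and inner: "\<And>v. v \<in> verts G \<Longrightarrow> dag G (out v) \<in> darcs G"
    and non_backtracking:
      "\<And>v. v \<in> verts G \<Longrightarrow> out (tgt G (dag G (out v))) \<noteq> dag G (out v)"
  shows "\<exists>as. is_cycle G as"
proof -
  \<comment> \<open>\<open>f v\<close> is the vertex at the far end of the chosen edge.\<close>
  define f where "f v = tgt G (dag G (out v))" for v
  have "f ` verts G \<subseteq> verts G" using inner graphD(7)[OF G] by (auto simp: f_def)
  with G ne graphD(2) obtain n u where n: "n > 0" and u: "u \<in> verts G" "(f ^^ n) u = u"
    and inj: "inj_on (\<lambda>i. (f ^^ i) u) {..<n}"
    by (metis finite_self_map_minimal_period)
  define vs where "vs i = (f ^^ i) u" for i
  have vs: "vs i \<in> verts G" for i
    using u(1) \<open>f ` verts G \<subseteq> verts G\<close> by (induction i) (auto simp: vs_def)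
  have vs_mod: "vs (Suc i mod n) = f (vs i)" if "i < n" for i
    using that u(2) n by (cases "Suc i = n") (auto simp: vs_def mod_Suc)
  \<comment> \<open>The arc \<open>out (vs i)\<close> ends at \<open>vs i\<close>; its dagger runs
    from \<open>vs i\<close> to \<open>f (vs i)\<close>, which is the orientation that
    \<open>is_cycle\<close> asks for.\<close>
  define as where "as = map (\<lambda>i. dag G (out (vs i))) [0..<n]"
  have out': "out (vs i) \<in> darcs G" "tgt G (out (vs i)) = vs i" for i
    using out[OF vs[of i]] by (auto simp: nb_def)
  have dd: "dag G (dag G (out (vs i))) = out (vs i)" for i
    using graphD(4,6)[OF G] out' by blast
  have *: "as ! i = dag G (out (vs i))" if "i < n" for i using that by (simp add: as_def)
  have [simp]: "length as = n" by (simp add: as_def)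
  have "distinct (map (tgt G) as)"
  proof -
    \<comment> \<open>The targets are the orbit shifted cyclically by one, so distinctness comes
      from \<open>inj\<close> and the injectivity of the shift.\<close>
    have "inj_on (\<lambda>i. f (vs i)) {..<n}"
    proof (rule inj_onI)
      fix i j assume ij: "i \<in> {..<n}" "j \<in> {..<n}" "f (vs i) = f (vs j)"
      then have "vs (Suc i mod n) = vs (Suc j mod n)" by (simp add: vs_mod)
      then have "Suc i mod n = Suc j mod n" using inj n by (auto simp: inj_on_def vs_def)
      then show "i = j" using ij by (auto simp: mod_Suc split: if_splits)
    qed
    then show ?thesis
      by (simp add: as_def distinct_map comp_def f_def atLeast0LessThan)
  qed
  moreover have "tgt G (dag G (as ! (Suc i mod n))) = tgt G (as ! i)
      \<and> as ! (Suc i mod n) \<noteq> dag G (as ! i)" if "i < n" for i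
  proof -
    have "Suc i mod n < n" using n by simp
    then have e: "as ! (Suc i mod n) = dag G (out (f (vs i)))" "as ! i = dag G (out (vs i))"
      using * vs_mod that by auto
    have "dag G (out (f (vs i))) \<noteq> out (vs i)"
      using non_backtracking[OF vs[of i]] dd[of "Suc i mod n"] vs_mod[OF that]
      by (auto simp: f_def)
    then show ?thesis using e dd[of i] dd[of "Suc i mod n"] out'(2)[of "Suc i mod n"] vs_mod[OF that]
      by (simp add: f_def)
  qed
  moreover have "a \<in> darcs G \<and> dag G a \<in> darcs G" if "a \<in> set as" for a
    using that inner[OF vs] out' dd by (auto simp: as_def)
  moreover have "as \<noteq> []" using n by (simp add: as_def)
  ultimately show ?thesis unfolding is_cycle_def by auto
qed

lemma rooted_treeD:
  assumes "rooted_tree (T, x)"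
  shows "tree T" "connected_graph T" "graph T" "x \<in> arcs T \<rightarrow>\<^sub>E {1, -1}"
    "\<And>a. a \<in> arcs T \<Longrightarrow> x (dag T a) = - x a"
    "\<And>v. v \<in> verts T \<Longrightarrow> \<exists>!d. d \<in> nb T v \<and> x d = 1"
  using assms unfolding rooted_tree_def tree_def connected_graph_def by auto

lemma rooted_tree_val: "rooted_tree (T, x) \<Longrightarrow> a \<in> arcs T \<Longrightarrow> x a = 1 \<or> x a = -1"
  using rooted_treeD(4) by (fastforce simp: PiE_iff)

text \<open>Without a root every output edge is internal, since \<open>dag T (out v)\<close> has
  sign -1 and so cannot be a boundary arc. Following outputs never backtracks, because
  \<open>out\<close> takes only arcs of sign +1, and a cycle results.\<close>

lemma rooted_tree_ex_root:
  assumes R: "rooted_tree (T, x)"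
  shows "\<exists>a\<in>boundary T. x a = -1"
proof (rule ccontr)
  assume no_root: "\<not> ?thesis"
  note G = rooted_treeD(3)[OF R]
  define out where "out v = (THE d. d \<in> nb T v \<and> x d = 1)" for v
  have out: "out v \<in> nb T v" "x (out v) = 1" if "v \<in> verts T" for v
    using theI'[OF rooted_treeD(6)[OF R that]] by (auto simp: out_def)
  have arc: "out v \<in> arcs T" if "v \<in> verts T" for v
    using out(1)[OF that] graphD(6)[OF G] by (auto simp: nb_def)
  have ne: "arcs T \<noteq> {}"
    using rooted_treeD(2)[OF R] arc unfolding connected_graph_def by blast
  then obtain a where a: "a \<in> arcs T" "x a = -1"
    using rooted_tree_val[OF R] rooted_treeD(5)[OF R] graphD(3)[OF G] by fastforce
  then have "a \<in> darcs T" using no_root by (auto simp: boundary_def)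
  then have "verts T \<noteq> {}" using graphD(7)[OF G] by blast
  moreover have x: "x (dag T (out v)) = -1" if "v \<in> verts T" for v
    using rooted_treeD(5)[OF R arc[OF that]] out(2)[OF that] by simp
  moreover have inner: "dag T (out v) \<in> darcs T" if "v \<in> verts T" for v
    using no_root x[OF that] graphD(3)[OF G arc[OF that]] by (auto simp: boundary_def)
  moreover have "out (tgt T (dag T (out v))) \<noteq> dag T (out v)" if "v \<in> verts T" for v
  proof -
    have "tgt T (dag T (out v)) \<in> verts T" using inner[OF that] graphD(7)[OF G] by blast
    from out(2)[OF this] x[OF that] show ?thesis by auto
  qed
  ultimately have "\<exists>as. is_cycle T as"
    using cycle_of_non_backtracking_choice[OF G, of out] out(1) by blast
  then show False using rooted_treeD(1)[OF R] by (simp add: tree_def)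
qed

text \<open>The arcs and vertices from which the descent along \<open>x\<close> ends in a given root form a
  connected component.\<close>

lemma rooted_tree_root_unique:
  assumes R: "rooted_tree (T, x)" and a: "a \<in> boundary T" "x a = -1"
    and b: "b \<in> boundary T" "x b = -1"
  shows "a = b"
proof (rule ccontr)
  assume "a \<noteq> b"
  note G = rooted_treeD(3)[OF R]
  note dag_x = rooted_treeD(5)[OF R]
  \<comment> \<open>\<open>step\<close> descends through a vertex, from a negative arc
    \<open>c\<close> ending there to the negative arc leaving through its output \<open>d\<close>.
    \<open>down\<close> picks the negative arc of an edge, so membership in \<open>A\<close> depends
    on the edge only.\<close>
  define step where
    "step = {(c, dag T d) | c d. c \<in> darcs T \<and> x c = -1 \<and> d \<in> nb T (tgt T c) \<and> x d = 1}"
  define down where "down c = (if x c = -1 then c else dag T c)" for c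
  define A where "A = {c \<in> arcs T. (down c, a) \<in> step\<^sup>*}"
  define V where "V = {v \<in> verts T. \<exists>d\<in>nb T v. x d = 1 \<and> d \<in> A}"
  have down_dag: "down (dag T c) = down c" if "c \<in> arcs T" for c
    using rooted_tree_val[OF R that] dag_x[OF that] graphD(4)[OF G that]
    by (auto simp: down_def)
  have dag_A: "dag T c \<in> A \<longleftrightarrow> c \<in> A" if "c \<in> arcs T" for c
    using that down_dag[OF that] graphD(3)[OF G] by (auto simp: A_def)
  have tgt_V: "tgt T d \<in> V \<longleftrightarrow> d \<in> A" if d: "d \<in> darcs T" for d
  proof -
    have dv: "tgt T d \<in> verts T" "d \<in> arcs T" "d \<in> nb T (tgt T d)"
      using d graphD(6,7)[OF G] by (auto simp: nb_def)
    obtain e where e: "e \<in> nb T (tgt T d)" "x e = 1"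
      and e_uniq: "\<And>e'. e' \<in> nb T (tgt T d) \<Longrightarrow> x e' = 1 \<Longrightarrow> e' = e"
      using rooted_treeD(6)[OF R dv(1)] by blast
    have e_arc: "e \<in> arcs T" using e(1) graphD(6)[OF G] by (auto simp: nb_def)
    have V: "tgt T d \<in> V \<longleftrightarrow> e \<in> A" using e e_uniq dv(1) unfolding V_def by blast
    show ?thesis
    proof (cases "x d = 1")
      case True
      then have "d = e" using e_uniq dv(3) by blast
      then show ?thesis using V by simp
    next
      case False
      then have xd: "x d = -1" using rooted_tree_val[OF R dv(2)] by auto
      have "d \<noteq> a" using d a(1) by (auto simp: boundary_def)
      \<comment> \<open>The output is unique, so \<open>d\<close> has exactly one successor. As
        \<open>d\<close> differs from the boundary arc \<open>a\<close>, reaching \<open>a\<close>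
        from \<open>d\<close> means reaching it from that successor.\<close>
      have step: "(d, c) \<in> step \<longleftrightarrow> c = dag T e" for c
        using d xd e e_uniq unfolding step_def by blast
      have "(d, a) \<in> step\<^sup>* \<longleftrightarrow> (dag T e, a) \<in> step\<^sup>*"
        using \<open>d \<noteq> a\<close> step by (metis converse_rtranclE converse_rtrancl_into_rtrancl)
      moreover have "down e = dag T e" "down d = d" using e(2) xd by (auto simp: down_def)
      ultimately show ?thesis using V e_arc dv(2) by (auto simp: A_def)
    qed
  qed
  have "a \<in> A" using a by (auto simp: A_def down_def boundary_def)
  \<comment> \<open>Boundary arcs have no successor under \<open>step\<close>, so \<open>b\<close>
    reaches nothing but itself.\<close>
  have "b \<notin> A"
  proof
    assume "b \<in> A"
    then have "(b, a) \<in> step\<^sup>*" using b(2) by (auto simp: A_def down_def)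
    then show False
      using \<open>a \<noteq> b\<close> b(1) by (auto simp: boundary_def step_def elim: converse_rtranclE)
  qed
  have "splits T A V (arcs T - A) (verts T - V)"
    unfolding splits_def
    using \<open>a \<in> A\<close> \<open>b \<notin> A\<close> b(1) dag_A tgt_V graphD(3,7)[OF G]
    by (auto simp: boundary_def A_def V_def)
  then show False using rooted_treeD(2)[OF R] by (auto simp: connected_graph_def)
qed

lemma rooted_tree_root:
  "rooted_tree (T, x) \<Longrightarrow> \<exists>!a. a \<in> boundary T \<and> x a = -1"
  using rooted_tree_ex_root rooted_tree_root_unique by metis


section \<open>Rootings pull back along graphical maps\<close>

lemma etaleD:
  assumes "etale H G f"
  shows "graph H" "graph G" "amap f \<in> arcs H \<rightarrow>\<^sub>E arcs G" "vmap f \<in> verts H \<rightarrow>\<^sub>E verts G"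
    "\<And>a. a \<in> arcs H \<Longrightarrow> amap f a \<in> arcs G"
    "\<And>v. v \<in> verts H \<Longrightarrow> vmap f v \<in> verts G"
    "\<And>a. a \<in> arcs H \<Longrightarrow> amap f (dag H a) = dag G (amap f a)"
    "\<And>d. d \<in> darcs H \<Longrightarrow> amap f d \<in> darcs G"
    "\<And>d. d \<in> darcs H \<Longrightarrow> tgt G (amap f d) = vmap f (tgt H d)"
    "\<And>v. v \<in> verts H \<Longrightarrow> bij_betw (amap f) (nb H v) (nb G (vmap f v))"
  using assms unfolding etale_def by (auto simp: PiE_iff)

lemma embedding_preserves_cycles:
  assumes "embedding H G f" and cyc: "is_cycle H as"
  shows "is_cycle G (map (amap f) as)"
proof -
  have E: "etale H G f" and inj: "inj_on (vmap f) (verts H)"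
    using assms(1) by (auto simp: embedding_def)
  note f = etaleD[OF E]
  note H = graphD[OF f(1)]
  have as: "as \<noteq> []" "distinct (map (tgt H) as)"
    and as_d: "\<And>i. i < length as \<Longrightarrow> as ! i \<in> darcs H \<and> dag H (as ! i) \<in> darcs H"
    and as_step: "\<And>i. i < length as \<Longrightarrow>
      tgt H (dag H (as ! (Suc i mod length as))) = tgt H (as ! i) \<and>
      as ! (Suc i mod length as) \<noteq> dag H (as ! i)"
    using cyc by (auto simp: is_cycle_def)
  have tgt: "\<forall>a\<in>set as. tgt G (amap f a) = vmap f (tgt H a)"
    using cyc f(9) by (simp add: is_cycle_def)
  have "distinct (map (tgt G \<circ> amap f) as)"
  proof -
    have "inj_on (vmap f) (set (map (tgt H) as))"
      using inj by (rule inj_on_subset) (use cyc H(7) in \<open>auto simp: is_cycle_def\<close>)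
    then have "distinct (map (vmap f) (map (tgt H) as))"
      using as(2) by (simp only: distinct_map[of "vmap f"])
    moreover have "map (vmap f) (map (tgt H) as) = map (tgt G \<circ> amap f) as"
      using tgt by auto
    ultimately show ?thesis by (simp only:)
  qed
  moreover have "tgt G (dag G (amap f (as ! (Suc i mod length as)))) = tgt G (amap f (as ! i)) \<and>
      amap f (as ! (Suc i mod length as)) \<noteq> dag G (amap f (as ! i))" if "i < length as" for i
  proof -
    let ?b = "as ! (Suc i mod length as)" and ?a = "as ! i"
    have "Suc i mod length as < length as" using as(1) by simp
    then have b: "?b \<in> darcs H" "dag H ?b \<in> darcs H" and a: "?a \<in> darcs H"
      using as_d that by blast+
    have fb: "dag G (amap f ?b) = amap f (dag H ?b)" using f(7) H(6) b(1) by simp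
    have "amap f ?b \<noteq> dag G (amap f ?a)"
    proof
      assume "amap f ?b = dag G (amap f ?a)"
      then have "amap f (dag H ?b) = amap f ?a"
        using fb graphD(4)[OF f(2)] f(5) H(6) a by simp
      moreover have "dag H ?b \<in> nb H (tgt H ?a)" "?a \<in> nb H (tgt H ?a)"
        using a b(2) as_step[OF that] by (auto simp: nb_def)
      ultimately have "dag H ?b = ?a"
        using f(10)[OF H(7)[OF a]] by (auto simp: bij_betw_def dest: inj_onD)
      then show False using as_step[OF that] H(4,6) b(1) by metis
    qed
    then show ?thesis using fb f(9) a b as_step[OF that] by simp
  qed
  moreover have "amap f a \<in> darcs G \<and> dag G (amap f a) \<in> darcs G" if "a \<in> set as" for a
    using that cyc f(8) f(7)[symmetric] H(6) by (auto simp: is_cycle_def)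
  ultimately show ?thesis
    using as(1) unfolding is_cycle_def by auto
qed

lemma embedding_into_tree:
  assumes "embedding H T f" "tree T"
  shows "tree H"
  using assms embedding_preserves_cycles[OF assms(1)] unfolding tree_def embedding_def by blast

text \<open>Used to move the unique output of a vertex, or the unique root of a subtree, along the
  bijections contained in etale and graphical maps.\<close>

lemma bij_betw_Ex1_iff:
  assumes "bij_betw f A B"
  shows "(\<exists>!b. b \<in> B \<and> P b) \<longleftrightarrow> (\<exists>!a. a \<in> A \<and> P (f a))"
proof -
  have "f ` A = B" and inj: "inj_on f A" using assms by (auto simp: bij_betw_def)
  then have "(\<exists>b\<in>B. P b \<and> (\<forall>c\<in>B. P c \<longrightarrow> c = b)) \<longleftrightarrow>
      (\<exists>a\<in>A. P (f a) \<and> (\<forall>c\<in>A. P (f c) \<longrightarrow> f c = f a))"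
    by blast
  also have "\<dots> \<longleftrightarrow> (\<exists>a\<in>A. P (f a) \<and> (\<forall>c\<in>A. P (f c) \<longrightarrow> c = a))"
    using inj by (simp add: inj_on_eq_iff cong: bex_cong ball_cong)
  finally show ?thesis unfolding Ex1_def by blast
qed

text \<open>The output condition looks at one neighbourhood at a time, and an etale map is bijective
  on each of them.\<close>

lemma rooting_along_embedding:
  assumes emb: "embedding H T f" and R: "rooted_tree (T, x)"
  shows "rooted_tree (H, restrict (x \<circ> amap f) (arcs H))"
proof -
  let ?y = "restrict (x \<circ> amap f) (arcs H)"
  have "etale H T f" using emb by (simp add: embedding_def)
  note f = etaleD[OF this]
  note H = graphD[OF f(1)]
  have "\<exists>!d. d \<in> nb H v \<and> ?y d = 1" if v: "v \<in> verts H" for v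
  proof -
    have arc: "d \<in> arcs H" if "d \<in> nb H v" for d using that H(6) by (simp add: nb_def)
    have "\<exists>!d. d \<in> nb T (vmap f v) \<and> x d = 1" using rooted_treeD(6)[OF R f(6)[OF v]] .
    then have "\<exists>!d. d \<in> nb H v \<and> x (amap f d) = 1"
      by (simp add: bij_betw_Ex1_iff[OF f(10)[OF v]])
    then show ?thesis using arc by auto
  qed
  moreover have "?y \<in> arcs H \<rightarrow>\<^sub>E {1, -1}"
    using rooted_treeD(4)[OF R] f(5) by (auto simp: PiE_iff)
  moreover have "\<forall>a\<in>arcs H. ?y (dag H a) = - ?y a"
    using rooted_treeD(5)[OF R] f(5,7) H(3) by simp
  ultimately show ?thesis
    using embedding_into_tree[OF emb rooted_treeD(1)[OF R]] by (simp add: rooted_tree_def)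
qed

lemma graph_isoD:
  assumes "graph_iso K H z"
  shows "etale K H z" "amap z ` arcs K = arcs H" "amap z ` boundary K = boundary H"
    "vmap z ` verts K = verts H"
proof -
  show E: "etale K H z" "amap z ` arcs K = arcs H" "vmap z ` verts K = verts H"
    using assms by (auto simp: graph_iso_def bij_betw_def)
  have "amap z ` boundary K = amap z ` arcs K - amap z ` darcs K"
    using assms graphD(6)[OF etaleD(1)[OF E(1)]] unfolding boundary_def
    by (intro inj_on_image_set_diff[of _ "arcs K"]) (auto simp: graph_iso_def bij_betw_def)
  then show "amap z ` boundary K = boundary H"
    using assms by (simp add: boundary_def graph_iso_def bij_betw_def)
qed

lemma emb_class_images:
  assumes "(K, g) \<in> emb_class H f"
  shows "amap g ` boundary K = amap f ` boundary H" "vmap g ` verts K = vmap f ` verts H"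
proof -
  obtain z where z: "graph_iso K H z" and g: "g = gmap_comp K f z"
    using assms by (auto simp: emb_class_def)
  have "amap g ` boundary K = amap f ` amap z ` boundary K"
    unfolding g by (force simp: gmap_comp_def compose_def boundary_def image_image)
  then show "amap g ` boundary K = amap f ` boundary H" using graph_isoD(3)[OF z] by simp
  have "vmap g ` verts K = vmap f ` vmap z ` verts K"
    unfolding g by (force simp: gmap_comp_def compose_def image_image)
  then show "vmap g ` verts K = vmap f ` verts H" using graph_isoD(4)[OF z] by simp
qed

lemma emb_class_boundary:
  assumes "emb_class H f \<noteq> {}"
  shows "emb_boundary (emb_class H f) = amap f ` boundary H"
  using assms emb_class_images(1)[of _ _ H f] unfolding emb_boundary_def by fastforce

lemma graph_iso_id: "graph G \<Longrightarrow> graph_iso G G (gmap_id G)"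
proof -
  assume G: "graph G"
  have nb: "nb G v \<subseteq> arcs G" for v using graphD(6)[OF G] by (auto simp: nb_def)
  have "bij_betw (restrict id (arcs G)) A A" if "A \<subseteq> arcs G" for A
    using that by (intro bij_betwI[where g = id]) auto
  moreover have "bij_betw (restrict id (verts G)) (verts G) (verts G)"
    by (intro bij_betwI[where g = id]) auto
  ultimately show ?thesis
    using G nb graphD[OF G] subsetI[of "darcs G" "arcs G"] unfolding graph_iso_def etale_def gmap_id_def
    by (simp add: PiE_iff)
qed

lemma emb_class_self:
  assumes "etale H G f"
  shows "(H, f) \<in> emb_class H f"
proof -
  note f = etaleD[OF assms]
  have "f = gmap_comp H f (gmap_id H)"
    using f(3,4)
    by (intro gmap.equality ext) (auto simp: gmap_comp_def gmap_id_def compose_def PiE_iff extensional_def)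
  then show ?thesis using graph_iso_id[OF f(1)] by (auto simp: emb_class_def)
qed

text \<open>A representative pulls the rooting back to its domain, and the unique root found there
  is carried onto the boundary of the class.\<close>

lemma Emb_one_root:
  assumes R: "rooted_tree (T, x)" and e: "e \<in> Emb T"
  shows "\<exists>!a. a \<in> emb_boundary e \<and> x a = -1"
proof -
  obtain H :: ngraph and f where ef: "e = emb_class H f" and emb: "embedding H T f"
    using e by (auto simp: Emb_def)
  have "emb_boundary e = amap f ` boundary H"
    using emb emb_class_boundary emb_class_self unfolding ef embedding_def by blast
  moreover have "\<exists>!a. a \<in> boundary H \<and> restrict (x \<circ> amap f) (arcs H) a = -1"
    using rooted_tree_root[OF rooting_along_embedding[OF emb R]] .
  then have "\<exists>!a. a \<in> boundary H \<and> x (amap f a) = -1"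
    by (auto simp: boundary_def)
  ultimately show ?thesis by (metis imageE imageI)
qed

text \<open>The restriction makes the result extensional, so that equal rootings are equal functions
  and pulling back is strictly functorial.\<close>

definition pull_rooting :: "ngraph \<Rightarrow> graphical \<Rightarrow> (nat \<Rightarrow> int) \<Rightarrow> nat \<Rightarrow> int" where
  "pull_rooting T \<phi> x = restrict (x \<circ> garc \<phi>) (arcs T)"

lemma graphical_mapD:
  assumes "graphical_map T T' \<phi>"
  shows "garc \<phi> \<in> arcs T \<rightarrow>\<^sub>E arcs T'"
    "\<And>a. a \<in> arcs T \<Longrightarrow> garc \<phi> a \<in> arcs T'"
    "\<And>a. a \<in> arcs T \<Longrightarrow> garc \<phi> (dag T a) = dag T' (garc \<phi> a)"
    "\<And>v. v \<in> verts T \<Longrightarrow> gvert \<phi> v \<in> Emb T'"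
    "\<And>v. v \<in> verts T \<Longrightarrow>
      bij_betw (\<lambda>a. garc \<phi> (dag T a)) (nb T v) (emb_boundary (gvert \<phi> v))"
  using assms unfolding graphical_map_def by (auto simp: PiE_iff)

text \<open>The boundary bijection matches \<open>nb T v\<close> with the boundary of the subtree
  \<open>gvert \<phi> v\<close> after a dagger, which reverses signs. Hence the single root of that
  subtree, of sign -1, becomes the single arc of sign +1 at \<open>v\<close>.\<close>

lemma rooted_tree_pull:
  assumes \<phi>: "graphical_map T T' \<phi>" and T: "tree T" and R: "rooted_tree (T', x)"
  shows "rooted_tree (T, pull_rooting T \<phi> x)"
proof -
  let ?y = "pull_rooting T \<phi> x"
  note \<phi>' = graphical_mapD[OF \<phi>]
  have "graph T" using T by (simp add: tree_def connected_graph_def)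
  note G = graphD[OF this]
  have y: "?y a = x (garc \<phi> a)" if "a \<in> arcs T" for a using that by (simp add: pull_rooting_def)
  have y_dag: "?y (dag T a) = - ?y a" if "a \<in> arcs T" for a
    using that y G(3) \<phi>'(2,3) rooted_treeD(5)[OF R] by simp
  have "\<exists>!d. d \<in> nb T v \<and> ?y d = 1" if v: "v \<in> verts T" for v
  proof -
    have arc: "d \<in> arcs T" if "d \<in> nb T v" for d using that G(6) by (simp add: nb_def)
    have "\<exists>!a. a \<in> emb_boundary (gvert \<phi> v) \<and> x a = -1"
      using Emb_one_root[OF R \<phi>'(4)[OF v]] .
    then have "\<exists>!d. d \<in> nb T v \<and> x (garc \<phi> (dag T d)) = -1"
      by (simp add: bij_betw_Ex1_iff[OF \<phi>'(5)[OF v]])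
    moreover have "x (garc \<phi> (dag T d)) = -1 \<longleftrightarrow> ?y d = 1" if "d \<in> nb T v" for d
      using y_dag[OF arc[OF that]] y[OF G(3)[OF arc[OF that]]] by auto
    ultimately show ?thesis by metis
  qed
  moreover have "?y \<in> arcs T \<rightarrow>\<^sub>E {1, -1}"
    using rooted_treeD(4)[OF R] \<phi>'(2) by (auto simp: PiE_iff pull_rooting_def)
  ultimately show ?thesis using T y_dag by (simp add: rooted_tree_def)
qed

lemma pull_rooting_id: "rooted_tree (T, x) \<Longrightarrow> pull_rooting T (graphical_id T) x = x"
  using rooted_treeD(4)[of T x]
  by (auto simp: pull_rooting_def graphical_id_def graphical_of_embedding_def gmap_id_def
      PiE_iff extensional_def)

lemma pull_rooting_comp:
  assumes "graphical_map T T' \<phi>"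
  shows "pull_rooting T (graphical_comp T T' T'' \<psi> \<phi>) x = pull_rooting T \<phi> (pull_rooting T' \<psi> x)"
  using graphical_mapD(2)[OF assms]
  by (auto simp: pull_rooting_def graphical_comp_def compose_def)

text \<open>The rooting of the source is forced by the map and the rooting of the target. With
  \<open>rooted_tree_pull\<close> this gives each graphical map a unique lift ending at a given
  rooting.\<close>

lemma Omega_hom_iff:
  assumes "rooted_tree (T, y)"
  shows "\<phi> \<in> hom Omega (T, y) (T', x) \<longleftrightarrow> graphical_map T T' \<phi> \<and> y = pull_rooting T \<phi> x"
  using rooted_treeD(4)[OF assms]
  by (fastforce simp: Omega_def Omega_hom_def pull_rooting_def PiE_iff extensional_def)

lemma ob_Omega [simp]: "S \<in> ob Omega \<longleftrightarrow> rooted_tree S"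
  by (simp add: Omega_def)

lemma ob_U_cyc [simp]: "T \<in> ob U_cyc \<longleftrightarrow> tree T \<and> boundary T \<noteq> {}"
  by (simp add: U_cyc_def)

lemma hom_U_cyc [simp]: "\<phi> \<in> hom U_cyc T T' \<longleftrightarrow> graphical_map T T' \<phi>"
  by (simp add: U_cyc_def)

text \<open>The root is itself a boundary arc, so the non-empty boundary required in
  \<open>U_cyc\<close> is automatic.\<close>

lemma forget_ob: "rooted_tree (T, x) \<Longrightarrow> T \<in> ob U_cyc"
  using rooted_tree_ex_root rooted_treeD(1) by fastforce

section \<open>The left Kan extension as a disjoint union over rootings\<close>

definition rooted_sections ::
  "(ngraph \<times> (nat \<Rightarrow> int), graphical, 's) psh \<Rightarrow> ngraph \<Rightarrow> ((nat \<Rightarrow> int) \<times> 's) set" where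
  "rooted_sections X T = (SIGMA x:{x. rooted_tree (T, x)}. pob X (T, x))"

text \<open>A property instead of a construction: it is invariant under isomorphisms compatible with
  \<open>\<eta>\<close>, hence can pass from one explicit model to every left Kan extension.\<close>

definition fibrewise_extension ::
  "(ngraph \<times> (nat \<Rightarrow> int), graphical, 's) psh \<Rightarrow> (ngraph, graphical, 's) psh \<Rightarrow>
   (ngraph \<times> (nat \<Rightarrow> int) \<Rightarrow> 's \<Rightarrow> 's) \<Rightarrow> bool" where
  "fibrewise_extension X Y \<eta> \<longleftrightarrow>
     presheaf U_cyc Y \<and> nat_trans Omega X (restriction forget Y) \<eta> \<and>
     (\<forall>T\<in>ob U_cyc. bij_betw (\<lambda>(x, z). \<eta> (T, x) z) (rooted_sections X T) (pob Y T))"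

lemma rooted_sections_iff [simp]:
  "(x, z) \<in> rooted_sections X T \<longleftrightarrow> rooted_tree (T, x) \<and> z \<in> pob X (T, x)"
  by (simp add: rooted_sections_def)

lemma restriction_forget [simp]:
  "pob (restriction forget Y) S = pob Y (fst S)"
  "pact (restriction forget Y) S S' = pact Y (fst S) (fst S')"
  by (auto simp: restriction_def forget_def)

lemma fob_forget [simp]: "fob forget S = fst S"
  by (simp add: forget_def)

lemma presheafD:
  assumes "presheaf C Z"
  shows "\<And>c d f z. c \<in> ob C \<Longrightarrow> d \<in> ob C \<Longrightarrow> f \<in> hom C c d \<Longrightarrow> z \<in> pob Z d \<Longrightarrow>
      pact Z c d f z \<in> pob Z c"
    "\<And>c z. c \<in> ob C \<Longrightarrow> z \<in> pob Z c \<Longrightarrow> pact Z c c (ident C c) z = z"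
    "\<And>b c d f g z. b \<in> ob C \<Longrightarrow> c \<in> ob C \<Longrightarrow> d \<in> ob C \<Longrightarrow> f \<in> hom C b c \<Longrightarrow> g \<in> hom C c d \<Longrightarrow>
      z \<in> pob Z d \<Longrightarrow> pact Z b d (cmp C b c d g f) z = pact Z b c f (pact Z c d g z)"
  using assms unfolding presheaf_def by blast+

lemma nat_transD:
  assumes "nat_trans C X Y \<alpha>"
  shows "\<And>c x. c \<in> ob C \<Longrightarrow> x \<in> pob X c \<Longrightarrow> \<alpha> c x \<in> pob Y c"
    "\<And>c d f x. c \<in> ob C \<Longrightarrow> d \<in> ob C \<Longrightarrow> f \<in> hom C c d \<Longrightarrow> x \<in> pob X d \<Longrightarrow>
      \<alpha> c (pact X c d f x) = pact Y c d f (\<alpha> d x)"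
    "\<And>c. c \<notin> ob C \<Longrightarrow> \<alpha> c = undefined"
    "\<And>c x. c \<in> ob C \<Longrightarrow> x \<notin> pob X c \<Longrightarrow> \<alpha> c x = undefined"
  using assms unfolding nat_trans_def by (auto simp: PiE_iff extensional_def)

lemma nat_transI:
  assumes "\<And>c x. c \<in> ob C \<Longrightarrow> x \<in> pob X c \<Longrightarrow> \<alpha> c x \<in> pob Y c"
    "\<And>c d f x. c \<in> ob C \<Longrightarrow> d \<in> ob C \<Longrightarrow> f \<in> hom C c d \<Longrightarrow> x \<in> pob X d \<Longrightarrow>
      \<alpha> c (pact X c d f x) = pact Y c d f (\<alpha> d x)"
    "\<And>c. c \<notin> ob C \<Longrightarrow> \<alpha> c = undefined"
    "\<And>c x. c \<in> ob C \<Longrightarrow> x \<notin> pob X c \<Longrightarrow> \<alpha> c x = undefined"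
  shows "nat_trans C X Y \<alpha>"
  using assms unfolding nat_trans_def by (auto simp: PiE_iff extensional_def)

lemma nat_trans_eqI:
  assumes "nat_trans C X Y \<alpha>" "nat_trans C X Y' \<beta>"
    "\<And>c x. c \<in> ob C \<Longrightarrow> x \<in> pob X c \<Longrightarrow> \<alpha> c x = \<beta> c x"
  shows "\<alpha> = \<beta>"
  using nat_transD(3,4)[OF assms(1)] nat_transD(3,4)[OF assms(2)] assms(3)
  by (intro ext) metis

lemma Omega_hom_pull:
  assumes "graphical_map T T' \<phi>" "tree T" "rooted_tree (T', x)"
  shows "(T, pull_rooting T \<phi> x) \<in> ob Omega"
    "\<phi> \<in> hom Omega (T, pull_rooting T \<phi> x) (T', x)"
  using rooted_tree_pull[OF assms] assms(1) by (simp_all add: Omega_hom_iff)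

text \<open>The last clause is naturality of \<open>\<eta>\<close> on the lift of
  \<open>\<phi>\<close> ending at \<open>(T', x)\<close>. As every section is a value of
  \<open>\<eta>\<close>, it determines the whole action of \<open>Y\<close>.\<close>

lemma fibrewise_extensionD:
  assumes "fibrewise_extension X Y \<eta>"
  shows "presheaf U_cyc Y" "nat_trans Omega X (restriction forget Y) \<eta>"
    "\<And>T x z. rooted_tree (T, x) \<Longrightarrow> z \<in> pob X (T, x) \<Longrightarrow> \<eta> (T, x) z \<in> pob Y T"
    "\<And>T x z x' z'. rooted_tree (T, x) \<Longrightarrow> z \<in> pob X (T, x) \<Longrightarrow> rooted_tree (T, x') \<Longrightarrow>
      z' \<in> pob X (T, x') \<Longrightarrow> \<eta> (T, x) z = \<eta> (T, x') z' \<Longrightarrow> x = x' \<and> z = z'"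
    "\<And>T y. T \<in> ob U_cyc \<Longrightarrow> y \<in> pob Y T \<Longrightarrow>
      \<exists>x z. rooted_tree (T, x) \<and> z \<in> pob X (T, x) \<and> y = \<eta> (T, x) z"
    "\<And>T T' \<phi> x z. T \<in> ob U_cyc \<Longrightarrow> graphical_map T T' \<phi> \<Longrightarrow> rooted_tree (T', x) \<Longrightarrow>
      z \<in> pob X (T', x) \<Longrightarrow> pact Y T T' \<phi> (\<eta> (T', x) z) =
        \<eta> (T, pull_rooting T \<phi> x) (pact X (T, pull_rooting T \<phi> x) (T', x) \<phi> z)"
proof -
  show P: "presheaf U_cyc Y" and N: "nat_trans Omega X (restriction forget Y) \<eta>"
    using assms by (auto simp: fibrewise_extension_def)
  have bij: "bij_betw (\<lambda>(x, z). \<eta> (T, x) z) (rooted_sections X T) (pob Y T)"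
    if "T \<in> ob U_cyc" for T
    using assms that by (auto simp: fibrewise_extension_def)
  show "\<eta> (T, x) z \<in> pob Y T" if "rooted_tree (T, x)" "z \<in> pob X (T, x)" for T x z
    using nat_transD(1)[OF N, of "(T, x)"] that by simp
  show "x = x' \<and> z = z'" if "rooted_tree (T, x)" "z \<in> pob X (T, x)" "rooted_tree (T, x')"
    "z' \<in> pob X (T, x')" "\<eta> (T, x) z = \<eta> (T, x') z'" for T x z x' z'
  proof -
    have "inj_on (\<lambda>(x, z). \<eta> (T, x) z) (rooted_sections X T)"
      using bij[OF forget_ob[OF that(1)]] by (simp add: bij_betw_def)
    then have "(x, z) = (x', z')" by (rule inj_onD) (use that in auto)
    then show ?thesis by simp
  qed
  show "\<exists>x z. rooted_tree (T, x) \<and> z \<in> pob X (T, x) \<and> y = \<eta> (T, x) z"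
    if "T \<in> ob U_cyc" "y \<in> pob Y T" for T y
  proof -
    have "y \<in> (\<lambda>(x, z). \<eta> (T, x) z) ` rooted_sections X T"
      using bij[OF that(1)] that(2) by (simp add: bij_betw_def)
    then obtain p where "p \<in> rooted_sections X T" "y = (\<lambda>(x, z). \<eta> (T, x) z) p" by blast
    then show ?thesis by (cases p) auto
  qed
  show "pact Y T T' \<phi> (\<eta> (T', x) z) =
      \<eta> (T, pull_rooting T \<phi> x) (pact X (T, pull_rooting T \<phi> x) (T', x) \<phi> z)"
    if "T \<in> ob U_cyc" "graphical_map T T' \<phi>" "rooted_tree (T', x)" "z \<in> pob X (T', x)"
    for T T' \<phi> x z
    using nat_transD(2)[OF N, of "(T, pull_rooting T \<phi> x)" "(T', x)" \<phi> z]
      Omega_hom_pull[OF that(2) _ that(3)] that by simp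
qed

text \<open>Each element of \<open>pob Y T\<close> is \<open>\<eta> (T, x) z\<close> for exactly one
  pair, so the factorisation of \<open>\<alpha>\<close> is forced to send it to
  \<open>\<alpha> (T, x) z\<close>, and this is well defined.\<close>

lemma fibrewise_extension_is_Kan:
  assumes X: "presheaf Omega X" and F: "fibrewise_extension X Y \<eta>"
  shows "left_Kan_extension Omega U_cyc forget X Y \<eta>"
proof -
  note Y = fibrewise_extensionD[OF F]
  have "\<exists>!\<beta>. nat_trans U_cyc Y Z \<beta> \<and>
      \<alpha> = (\<lambda>c\<in>ob Omega. compose (pob X c) (\<beta> (fob forget c)) (\<eta> c))"
    if Z: "presheaf U_cyc Z" and \<alpha>: "nat_trans Omega X (restriction forget Z) \<alpha>" for Z \<alpha>
  proof (rule ex1I)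
    define \<beta> where "\<beta> = (\<lambda>T\<in>ob U_cyc. \<lambda>y\<in>pob Y T.
      THE u. \<exists>x z. rooted_tree (T, x) \<and> z \<in> pob X (T, x) \<and> y = \<eta> (T, x) z \<and> u = \<alpha> (T, x) z)"
    have \<beta>_eq: "\<beta> T (\<eta> (T, x) z) = \<alpha> (T, x) z" if "rooted_tree (T, x)" "z \<in> pob X (T, x)" for T x z
    proof -
      have "(THE u. \<exists>x' z'. rooted_tree (T, x') \<and> z' \<in> pob X (T, x') \<and>
          \<eta> (T, x) z = \<eta> (T, x') z' \<and> u = \<alpha> (T, x') z') = \<alpha> (T, x) z"
        by (rule the_equality) (use that in \<open>auto dest: Y(4)\<close>)
      then show ?thesis
        using Y(3)[OF that] forget_ob[OF that(1)] unfolding \<beta>_def by simp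
    qed
    have "nat_trans U_cyc Y Z \<beta>"
    proof (rule nat_transI)
      fix T y assume T: "T \<in> ob U_cyc" "y \<in> pob Y T"
      from Y(5)[OF this] obtain x z where "rooted_tree (T, x)" "z \<in> pob X (T, x)" "y = \<eta> (T, x) z"
        by blast
      then show "\<beta> T y \<in> pob Z T" using \<beta>_eq nat_transD(1)[OF \<alpha>, of "(T, x)" z] by simp
    next
      fix T T' \<phi> y
      assume T: "T \<in> ob U_cyc" "T' \<in> ob U_cyc" and \<phi>: "\<phi> \<in> hom U_cyc T T'" and y: "y \<in> pob Y T'"
      from Y(5)[OF T(2) y] obtain x z
        where R: "rooted_tree (T', x)" and z: "z \<in> pob X (T', x)" and yz: "y = \<eta> (T', x) z"
        by blast
      \<comment> \<open>The lift of \<open>\<phi>\<close> at \<open>x\<close> is an arrow of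
        \<open>Omega\<close>, which reduces naturality of \<open>\<beta>\<close> to naturality of
        \<open>\<eta>\<close> and \<open>\<alpha>\<close>.\<close>
      let ?x = "pull_rooting T \<phi> x"
      have h: "(T, ?x) \<in> ob Omega" "\<phi> \<in> hom Omega (T, ?x) (T', x)"
        using Omega_hom_pull[OF _ _ R] \<phi> T by simp_all
      have pz: "pact X (T, ?x) (T', x) \<phi> z \<in> pob X (T, ?x)"
        using presheafD(1)[OF X h(1) _ h(2) z] R by simp
      have "\<beta> T (pact Y T T' \<phi> y) = \<alpha> (T, ?x) (pact X (T, ?x) (T', x) \<phi> z)"
        using Y(6)[OF T(1) _ R z] \<phi> \<beta>_eq[OF _ pz] h(1) by (simp add: yz)
      also have "\<dots> = pact Z T T' \<phi> (\<beta> T' y)"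
        using nat_transD(2)[OF \<alpha> h(1) _ h(2) z] R \<beta>_eq[OF R z] by (simp add: yz)
      finally show "\<beta> T (pact Y T T' \<phi> y) = pact Z T T' \<phi> (\<beta> T' y)" .
    qed (auto simp: \<beta>_def)
    moreover have "\<alpha> = (\<lambda>c\<in>ob Omega. compose (pob X c) (\<beta> (fob forget c)) (\<eta> c))"
    proof (intro ext)
      fix c z
      show "\<alpha> c z = (\<lambda>c\<in>ob Omega. compose (pob X c) (\<beta> (fob forget c)) (\<eta> c)) c z"
        using \<beta>_eq[of "fst c" "snd c" z] nat_transD(3,4)[OF \<alpha>, of c]
        by (auto simp: compose_def)
    qed
    ultimately show "nat_trans U_cyc Y Z \<beta> \<and>
      \<alpha> = (\<lambda>c\<in>ob Omega. compose (pob X c) (\<beta> (fob forget c)) (\<eta> c))" by blast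
    fix \<gamma> assume \<gamma>: "nat_trans U_cyc Y Z \<gamma> \<and>
      \<alpha> = (\<lambda>c\<in>ob Omega. compose (pob X c) (\<gamma> (fob forget c)) (\<eta> c))"
    show "\<gamma> = \<beta>"
    proof (rule nat_trans_eqI)
      fix T y assume T: "T \<in> ob U_cyc" "y \<in> pob Y T"
      from Y(5)[OF this] obtain x z where R: "rooted_tree (T, x)" "z \<in> pob X (T, x)"
        and y: "y = \<eta> (T, x) z" by blast
      have "\<alpha> (T, x) z = (\<lambda>c\<in>ob Omega. compose (pob X c) (\<gamma> (fob forget c)) (\<eta> c)) (T, x) z"
        using \<gamma> by simp
      then show "\<gamma> T y = \<beta> T y" using \<beta>_eq[OF R] R y by (simp add: compose_eq)
    qed (use \<gamma> \<open>nat_trans U_cyc Y Z \<beta>\<close> in blast)+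
  qed
  then show ?thesis using X Y(1,2) unfolding left_Kan_extension_def by blast
qed

section \<open>A model of the disjoint union inside the value type\<close>

lemma infinite_coding:
  includes cardinal_syntax
  assumes "infinite (UNIV :: 's set)"
  shows "\<exists>c :: nat \<times> 's \<Rightarrow> 's. inj c"
proof -
  have "|UNIV :: nat set| \<le>o |UNIV :: 's set|"
    using assms by (simp add: infinite_iff_card_of_nat)
  then have "|(UNIV :: nat set) \<times> (UNIV :: 's set)| \<le>o |UNIV :: 's set|"
    using card_of_Times_infinite[OF assms] ordIso_imp_ordLeq by blast
  then show ?thesis by (auto simp: card_of_ordLeq[symmetric])
qed

text \<open>Pairs of a rooting and an element do not have type \<open>'s\<close>. The rooting is
  replaced by its number and the pair coded back into \<open>'s\<close>, which is where infiniteness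
  of the value type enters.\<close>

lemma fibrewise_extension_exists:
  fixes X :: "(ngraph \<times> (nat \<Rightarrow> int), graphical, 's) psh"
  assumes inf: "infinite (UNIV :: 's set)" and X: "presheaf Omega X"
  shows "\<exists>Y \<eta>. fibrewise_extension X Y \<eta>"
proof -
  obtain code :: "nat \<times> 's \<Rightarrow> 's" where code: "inj code" using infinite_coding[OF inf] by blast
  define enc where
    "enc T = (\<lambda>(x, z). code (to_nat_on {x. rooted_tree (T, x)} x, z))" for T :: ngraph
  define dec where "dec T = inv_into (rooted_sections X T) (enc T)" for T
  \<comment> \<open>The numbering \<open>to_nat_on\<close> is injective because a finite set of arcs
    with two signs admits only finitely many rootings.\<close>
  have inj: "inj_on (enc T) (rooted_sections X T)" for T
  proof (cases "{x. rooted_tree (T, x)} = {}")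
    case False
    then have "finite (arcs T)" using graphD(1) rooted_treeD(3) by blast
    then have "finite (arcs T \<rightarrow>\<^sub>E {1, -1 :: int})" by (rule finite_PiE) auto
    then have "finite {x. rooted_tree (T, x)}"
      by (rule rev_finite_subset) (use rooted_treeD(4) in blast)
    then have "inj_on (to_nat_on {x. rooted_tree (T, x)}) {x. rooted_tree (T, x)}"
      by (intro inj_on_to_nat_on countable_finite)
    then show ?thesis
      using code by (auto simp: inj_on_def enc_def rooted_sections_def)
  qed (auto simp: rooted_sections_def)
  have dec: "dec T (enc T p) = p" if "p \<in> rooted_sections X T" for T p
    unfolding dec_def using inj that by (rule inv_into_f_f)
  \<comment> \<open>This is the action dictated by the unique lifts; its functoriality combines that
    of \<open>pull_rooting\<close> with the presheaf laws of \<open>X\<close>.\<close>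
  define act where "act T T' \<phi> = (\<lambda>(x, z).
    (pull_rooting T \<phi> x, pact X (T, pull_rooting T \<phi> x) (T', x) \<phi> z))" for T T' \<phi>
  have act: "act T T' \<phi> p \<in> rooted_sections X T"
    if "tree T" "graphical_map T T' \<phi>" "p \<in> rooted_sections X T'" for T T' \<phi> p
  proof (cases p)
    case (Pair x z)
    then show ?thesis
      using that Omega_hom_pull[OF that(2,1), of x]
      by (auto simp: act_def intro!: presheafD(1)[OF X])
  qed
  define Y where "Y = \<lparr>pob = (\<lambda>T. enc T ` rooted_sections X T),
    pact = (\<lambda>T T' \<phi> y. enc T (act T T' \<phi> (dec T' y)))\<rparr>"
  have Y: "pob Y T = enc T ` rooted_sections X T"
    "p \<in> rooted_sections X T' \<Longrightarrow> pact Y T T' \<phi> (enc T' p) = enc T (act T T' \<phi> p)" for T T' \<phi> p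
    using dec by (auto simp: Y_def)
  define \<eta> where "\<eta> = (\<lambda>S\<in>ob Omega. \<lambda>z\<in>pob X S. enc (fst S) (snd S, z))"
  have "presheaf U_cyc Y"
    unfolding presheaf_def
  proof (intro conjI ballI)
    fix T T' \<phi> assume "T \<in> ob U_cyc" "\<phi> \<in> hom U_cyc T T'"
    then show "pact Y T T' \<phi> \<in> pob Y T' \<rightarrow> pob Y T"
      using act by (auto simp: Y simp del: split_paired_All)
  next
    fix T y assume T: "T \<in> ob U_cyc" and "y \<in> pob Y T"
    then obtain x z where p: "(x, z) \<in> rooted_sections X T" "y = enc T (x, z)"
      unfolding Y by (metis imageE surj_pair)
    then have R: "rooted_tree (T, x)" by simp
    have "pact X (T, x) (T, x) (graphical_id T) z = z"
      using presheafD(2)[OF X, of "(T, x)" z] p by (simp add: Omega_def)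
    then have "act T T (graphical_id T) (x, z) = (x, z)"
      by (simp add: act_def pull_rooting_id[OF R])
    then show "pact Y T T (ident U_cyc T) y = y"
      using Y(2)[OF p(1)] p(2) by (simp add: U_cyc_def)
  next
    fix T1 T2 T3 \<phi> \<psi> y
    assume T: "T1 \<in> ob U_cyc" "T2 \<in> ob U_cyc" "T3 \<in> ob U_cyc"
      and \<phi>: "\<phi> \<in> hom U_cyc T1 T2" and \<psi>: "\<psi> \<in> hom U_cyc T2 T3" and "y \<in> pob Y T3"
    then obtain x z where p: "(x, z) \<in> rooted_sections X T3" "y = enc T3 (x, z)"
      unfolding Y by (metis imageE surj_pair)
    let ?x2 = "pull_rooting T2 \<psi> x" and ?x1 = "pull_rooting T1 \<phi> (pull_rooting T2 \<psi> x)"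
    have 2: "(T2, ?x2) \<in> ob Omega" "\<psi> \<in> hom Omega (T2, ?x2) (T3, x)"
      using Omega_hom_pull[of T2 T3 \<psi> x] \<psi> T p by auto
    have 1: "(T1, ?x1) \<in> ob Omega" "\<phi> \<in> hom Omega (T1, ?x1) (T2, ?x2)"
      using Omega_hom_pull[of T1 T2 \<phi> ?x2] \<phi> T 2 by auto
    have "act T1 T3 (graphical_comp T1 T2 T3 \<psi> \<phi>) (x, z) = act T1 T2 \<phi> (act T2 T3 \<psi> (x, z))"
      using presheafD(3)[OF X 1(1) 2(1) _ 1(2) 2(2), of z] p(1) \<phi>
      by (simp add: act_def pull_rooting_comp Omega_def)
    moreover have "act T2 T3 \<psi> (x, z) \<in> rooted_sections X T2" using act p(1) \<psi> T by auto
    ultimately show "pact Y T1 T3 (cmp U_cyc T1 T2 T3 \<psi> \<phi>) y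
        = pact Y T1 T2 \<phi> (pact Y T2 T3 \<psi> y)"
      using p by (simp add: Y U_cyc_def del: rooted_sections_iff)
  qed
  moreover have "nat_trans Omega X (restriction forget Y) \<eta>"
  proof (rule nat_transI)
    fix S z assume "S \<in> ob Omega" "z \<in> pob X S"
    then show "\<eta> S z \<in> pob (restriction forget Y) S"
      by (cases S) (auto simp: \<eta>_def Y)
  next
    fix S S' \<phi> z
    assume S: "S \<in> ob Omega" "S' \<in> ob Omega" and \<phi>: "\<phi> \<in> hom Omega S S'" and z: "z \<in> pob X S'"
    obtain T x T' x' where [simp]: "S = (T, x)" "S' = (T', x')" by fastforce
    have x: "x = pull_rooting T \<phi> x'" using \<phi> S Omega_hom_iff by auto
    have "pact X S S' \<phi> z \<in> pob X S" using presheafD(1)[OF X S \<phi> z] .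
    then show "\<eta> S (pact X S S' \<phi> z) = pact (restriction forget Y) S S' \<phi> (\<eta> S' z)"
      using S z Y(2)[of "(x', z)" T' T \<phi>] x by (simp add: \<eta>_def act_def)
  qed (auto simp: \<eta>_def)
  moreover have "bij_betw (\<lambda>(x, z). \<eta> (T, x) z) (rooted_sections X T) (pob Y T)" for T
  proof -
    have "bij_betw (enc T) (rooted_sections X T) (pob Y T)"
      using inj by (simp add: bij_betw_def Y)
    then show ?thesis
      by (rule bij_betw_cong[THEN iffD1, rotated]) (auto simp: \<eta>_def)
  qed
  ultimately show ?thesis unfolding fibrewise_extension_def by blast
qed

section \<open>Uniqueness of left Kan extensions\<close>

lemma left_Kan_extensionD:
  assumes F: "fob F ` ob C \<subseteq> ob D"
    "\<forall>c\<in>ob C. \<forall>d\<in>ob C. fhom F c d ` hom C c d \<subseteq> hom D (fob F c) (fob F d)"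
    and K: "left_Kan_extension C D F X Y \<eta>"
  shows "presheaf D Y" "nat_trans C X (restriction F Y) \<eta>"
    "\<And>Z \<alpha>. presheaf D Z \<Longrightarrow> nat_trans C X (restriction F Z) \<alpha> \<Longrightarrow>
      \<exists>\<beta>. nat_trans D Y Z \<beta> \<and> (\<forall>c\<in>ob C. \<forall>x\<in>pob X c. \<alpha> c x = \<beta> (fob F c) (\<eta> c x))"
    "\<And>Z \<beta> \<gamma>. presheaf D Z \<Longrightarrow> nat_trans D Y Z \<beta> \<Longrightarrow> nat_trans D Y Z \<gamma> \<Longrightarrow>
      (\<And>c x. c \<in> ob C \<Longrightarrow> x \<in> pob X c \<Longrightarrow> \<beta> (fob F c) (\<eta> c x) = \<gamma> (fob F c) (\<eta> c x)) \<Longrightarrow> \<beta> = \<gamma>"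
proof -
  show Y: "presheaf D Y" "nat_trans C X (restriction F Y) \<eta>"
    using K by (auto simp: left_Kan_extension_def)
  have X: "presheaf C X" using K by (simp add: left_Kan_extension_def)
  have UP: "\<exists>!\<beta>. nat_trans D Y Z \<beta> \<and>
      \<alpha> = (\<lambda>c\<in>ob C. compose (pob X c) (\<beta> (fob F c)) (\<eta> c))"
    if "presheaf D Z" "nat_trans C X (restriction F Z) \<alpha>" for Z \<alpha>
    using K that unfolding left_Kan_extension_def by blast
  show "\<exists>\<beta>. nat_trans D Y Z \<beta> \<and> (\<forall>c\<in>ob C. \<forall>x\<in>pob X c. \<alpha> c x = \<beta> (fob F c) (\<eta> c x))"
    if Z: "presheaf D Z" "nat_trans C X (restriction F Z) \<alpha>" for Z \<alpha>
  proof -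
    obtain \<beta> where "nat_trans D Y Z \<beta>"
      "\<alpha> = (\<lambda>c\<in>ob C. compose (pob X c) (\<beta> (fob F c)) (\<eta> c))"
      using UP[OF Z] by blast
    then show ?thesis by (intro exI[of _ \<beta>]) (simp add: compose_eq)
  qed
  show "\<beta> = \<gamma>" if Z: "presheaf D Z" and \<beta>: "nat_trans D Y Z \<beta>" and \<gamma>: "nat_trans D Y Z \<gamma>"
    and eq: "\<And>c x. c \<in> ob C \<Longrightarrow> x \<in> pob X c \<Longrightarrow> \<beta> (fob F c) (\<eta> c x) = \<gamma> (fob F c) (\<eta> c x)"
    for Z \<beta> \<gamma>
  proof -
    let ?\<alpha> = "\<lambda>\<beta>. \<lambda>c\<in>ob C. compose (pob X c) (\<beta> (fob F c)) (\<eta> c)"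
    \<comment> \<open>The universal property speaks about natural \<open>\<alpha>\<close> only, so
      the composite of \<open>\<beta>\<close> with the unit has to be natural before its two
      factorisations \<open>\<beta>\<close> and \<open>\<gamma>\<close> can be compared.\<close>
    have N: "nat_trans C X (restriction F Z) (?\<alpha> \<beta>)"
    proof (rule nat_transI)
      fix c x assume "c \<in> ob C" "x \<in> pob X c"
      then show "?\<alpha> \<beta> c x \<in> pob (restriction F Z) c"
        using nat_transD(1)[OF Y(2)] nat_transD(1)[OF \<beta>] F(1)
        by (auto simp: compose_eq restriction_def)
    next
      fix c d f x
      assume cd: "c \<in> ob C" "d \<in> ob C" and f: "f \<in> hom C c d" and x: "x \<in> pob X d"
      have Fcd: "fob F c \<in> ob D" "fob F d \<in> ob D" using F(1) cd by auto
      have Ff: "fhom F c d f \<in> hom D (fob F c) (fob F d)" using F(2) cd f by blast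
      have "\<eta> d x \<in> pob Y (fob F d)"
        using nat_transD(1)[OF Y(2) cd(2) x] by (simp add: restriction_def)
      then have "\<beta> (fob F c) (\<eta> c (pact X c d f x)) =
          pact Z (fob F c) (fob F d) (fhom F c d f) (\<beta> (fob F d) (\<eta> d x))"
        using nat_transD(2)[OF Y(2) cd f x] nat_transD(2)[OF \<beta> Fcd Ff]
        by (simp add: restriction_def)
      then show "?\<alpha> \<beta> c (pact X c d f x) = pact (restriction F Z) c d f (?\<alpha> \<beta> d x)"
        using cd x presheafD(1)[OF X cd f x] by (simp add: compose_eq restriction_def)
    qed (auto simp: compose_def)
    have same: "?\<alpha> \<beta> = ?\<alpha> \<gamma>"
      using eq by (auto simp: compose_def intro!: restrict_ext)
    obtain \<delta> where \<delta>: "\<And>\<epsilon>. nat_trans D Y Z \<epsilon> \<and> ?\<alpha> \<beta> = ?\<alpha> \<epsilon> \<Longrightarrow> \<epsilon> = \<delta>"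
      using UP[OF Z N] by (elim ex1E) blast
    show ?thesis using \<delta>[OF conjI[OF \<beta> refl]] \<delta>[OF conjI[OF \<gamma> same]] by simp
  qed
qed

text \<open>Each unit factors through the other, and both round trips agree with the identity
  because they agree on a unit. Only what the transfer of \<open>fibrewise_extension\<close> uses is
  recorded: pointwise bijections compatible with the units.\<close>

lemma left_Kan_extension_unique:
  fixes X :: "('o, 'm, 's) psh" and Y Y' :: "('p, 'n, 's) psh"
  assumes F: "fob F ` ob C \<subseteq> ob D"
    "\<forall>c\<in>ob C. \<forall>d\<in>ob C. fhom F c d ` hom C c d \<subseteq> hom D (fob F c) (fob F d)"
    and K: "left_Kan_extension C D F X Y \<eta>" and K': "left_Kan_extension C D F X Y' \<eta>'"
  obtains \<gamma> where "\<And>d. d \<in> ob D \<Longrightarrow> bij_betw (\<gamma> d) (pob Y d) (pob Y' d)"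
    "\<And>c x. c \<in> ob C \<Longrightarrow> x \<in> pob X c \<Longrightarrow> \<eta>' c x = \<gamma> (fob F c) (\<eta> c x)"
proof -
  note D = left_Kan_extensionD[OF F]
  define connects where "connects Y Y' \<eta> \<eta>' \<gamma> \<longleftrightarrow>
      nat_trans D Y Y' \<gamma> \<and> (\<forall>c\<in>ob C. \<forall>x\<in>pob X c. \<eta>' c x = \<gamma> (fob F c) (\<eta> c x))"
    for Y Y' :: "('p, 'n, 's) psh" and \<eta> \<eta>' :: "'o \<Rightarrow> 's \<Rightarrow> 's" and \<gamma>
  have retraction: "\<delta> d (\<gamma> d y) = y"
    if K: "left_Kan_extension C D F X Y \<eta>" and \<gamma>: "connects Y Y' \<eta> \<eta>' \<gamma>"
      and \<delta>: "connects Y' Y \<eta>' \<eta> \<delta>" and d: "d \<in> ob D" "y \<in> pob Y d"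
    for Y Y' :: "('p, 'n, 's) psh" and \<eta> \<eta>' \<gamma> \<delta> d y
  proof -
    have N: "nat_trans D Y Y' \<gamma>" "nat_trans D Y' Y \<delta>"
      using \<gamma> \<delta> by (simp_all add: connects_def)
    note g = nat_transD[OF N(1)] and h = nat_transD[OF N(2)]
    have \<eta>: "\<eta> c x \<in> pob Y (fob F c)" if "c \<in> ob C" "x \<in> pob X c" for c x
      using nat_transD(1)[OF D(2)[OF K] that] by (simp add: restriction_def)
    \<comment> \<open>\<open>nat_trans\<close> demands extensional components, so the round trip and
      the identity are both cut down to the values of \<open>Y\<close> before uniqueness is
      applied.\<close>
    define \<epsilon> where "\<epsilon> = (\<lambda>d\<in>ob D. \<lambda>y\<in>pob Y d. \<delta> d (\<gamma> d y))"
    define \<iota> where "\<iota> = (\<lambda>d\<in>ob D. \<lambda>y\<in>pob Y d. y)"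
    note act = presheafD(1)[OF D(1)[OF K]]
    have "nat_trans D Y Y \<epsilon>" by (rule nat_transI) (auto simp: \<epsilon>_def g(1,2) h(1,2) act)
    moreover have "nat_trans D Y Y \<iota>" by (rule nat_transI) (auto simp: \<iota>_def act)
    moreover have "\<epsilon> (fob F c) (\<eta> c x) = \<iota> (fob F c) (\<eta> c x)" if "c \<in> ob C" "x \<in> pob X c" for c x
      using that \<gamma> \<delta> \<eta>[OF that] F(1) by (auto simp: connects_def \<epsilon>_def \<iota>_def)
    ultimately have "\<epsilon> = \<iota>" by (rule D(4)[OF K D(1)[OF K]])
    then have "\<epsilon> d y = \<iota> d y" by simp
    then show ?thesis using d by (simp add: \<epsilon>_def \<iota>_def)
  qed
  obtain \<gamma> where \<gamma>: "connects Y Y' \<eta> \<eta>' \<gamma>"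
    using D(3)[OF K D(1,2)[OF K']] by (auto simp: connects_def)
  obtain \<delta> where \<delta>: "connects Y' Y \<eta>' \<eta> \<delta>"
    using D(3)[OF K' D(1,2)[OF K]] by (auto simp: connects_def)
  have "bij_betw (\<gamma> d) (pob Y d) (pob Y' d)" if "d \<in> ob D" for d
    using retraction[OF K \<gamma> \<delta> that] retraction[OF K' \<delta> \<gamma> that] \<gamma> \<delta> that
    by (intro bij_betwI[where g = "\<delta> d"]) (auto simp: connects_def dest: nat_transD(1))
  then show thesis using that[of \<gamma>] \<gamma> by (simp add: connects_def)
qed

text \<open>The coded model is a left Kan extension as well, and bijectivity of its joint unit
  travels along the comparison \<open>\<gamma>\<close>.\<close>

lemma Kan_extension_is_fibrewise:
  fixes X :: "(ngraph \<times> (nat \<Rightarrow> int), graphical, 's) psh"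
  assumes inf: "infinite (UNIV :: 's set)" and X: "presheaf Omega X"
    and K: "left_Kan_extension Omega U_cyc forget X Y \<eta>"
  shows "fibrewise_extension X Y \<eta>"
proof -
  obtain Y' \<eta>' where F': "fibrewise_extension X Y' \<eta>'"
    using fibrewise_extension_exists[OF inf X] by blast
  have F: "fob forget ` ob Omega \<subseteq> ob U_cyc" using forget_ob by auto
  have F_hom: "\<forall>S\<in>ob Omega. \<forall>S'\<in>ob Omega.
      fhom forget S S' ` hom Omega S S' \<subseteq> hom U_cyc (fob forget S) (fob forget S')"
    by (auto simp: forget_def Omega_hom_iff)
  obtain \<gamma> where \<gamma>: "\<And>T. T \<in> ob U_cyc \<Longrightarrow> bij_betw (\<gamma> T) (pob Y' T) (pob Y T)"
    "\<And>S x. S \<in> ob Omega \<Longrightarrow> x \<in> pob X S \<Longrightarrow> \<eta> S x = \<gamma> (fob forget S) (\<eta>' S x)"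
    using left_Kan_extension_unique[OF F F_hom fibrewise_extension_is_Kan[OF X F'] K] by blast
  have "bij_betw (\<lambda>(x, z). \<eta> (T, x) z) (rooted_sections X T) (pob Y T)" if T: "T \<in> ob U_cyc" for T
  proof -
    have "bij_betw (\<gamma> T \<circ> (\<lambda>(x, z). \<eta>' (T, x) z)) (rooted_sections X T) (pob Y T)"
      using F' T \<gamma>(1)[OF T] by (auto simp: fibrewise_extension_def intro: bij_betw_trans)
    then show ?thesis
      by (rule bij_betw_cong[THEN iffD1, rotated]) (auto simp: \<gamma>(2))
  qed
  then show ?thesis
    using left_Kan_extensionD(1,2)[OF F F_hom K] by (simp add: fibrewise_extension_def)
qed

section \<open>Edges and stars with natural number labels\<close>

text \<open>The arcs of \<open>edge_graph\<close> and \<open>star n\<close> have other types, while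
  objects of \<open>U_cyc\<close> are labelled by natural numbers; test objects over a tree need
  copies of this kind.\<close>

definition nat_edge :: ngraph where
  "nat_edge = \<lparr>arcs = {0, 1}, verts = {}, dag = restrict (\<lambda>a. 1 - a) {0, 1}, darcs = {},
     tgt = (\<lambda>_. undefined)\<rparr>"

text \<open>The n-star with \<open>Inl a\<close> renamed to \<open>a\<close> and
  \<open>Inr a\<close> renamed to \<open>a + n\<close>.\<close>

definition nat_star :: "nat \<Rightarrow> ngraph" where
  "nat_star n = \<lparr>arcs = {1..2 * n}, verts = {0},
     dag = restrict (\<lambda>a. if a \<le> n then a + n else a - n) {1..2 * n},
     darcs = {1..n}, tgt = restrict (\<lambda>_. 0) {1..n}\<rparr>"

lemma nat_edge_simps [simp]:
  "arcs nat_edge = {0, 1}" "verts nat_edge = {}" "darcs nat_edge = {}"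
  "boundary nat_edge = {0, 1}" "dag nat_edge 0 = 1" "dag nat_edge (Suc 0) = 0"
  by (auto simp: nat_edge_def boundary_def)

lemma graph_nat_edge: "graph nat_edge"
  by (auto simp: graph_def nat_edge_def)

lemma tree_nat_edge: "tree nat_edge"
proof -
  have "\<not> splits nat_edge A1 V1 A2 V2" for A1 V1 A2 V2
  proof
    assume S: "splits nat_edge A1 V1 A2 V2"
    then have V: "V1 = {}" "V2 = {}" by (auto simp: splits_def)
    then have A: "A1 \<noteq> {}" "A2 \<noteq> {}" "A1 \<union> A2 = {0, Suc 0}" "A1 \<inter> A2 = {}"
      and dag: "dag nat_edge ` A1 \<subseteq> A1" "dag nat_edge ` A2 \<subseteq> A2"
      using S by (auto simp: splits_def)
    have "0 \<in> A" if "dag nat_edge ` A \<subseteq> A" "A \<noteq> {}" "A \<subseteq> {0, Suc 0}" for A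
    proof -
      have "dag nat_edge a \<in> A" if "a \<in> A" for a
        using that \<open>dag nat_edge ` A \<subseteq> A\<close> by blast
      from this[of 0] this[of "Suc 0"] show ?thesis using that(2,3) by auto
    qed
    from this[OF dag(1)] this[OF dag(2)] have "0 \<in> A1 \<inter> A2" using A(1-3) by blast
    then show False using A(4) by simp
  qed
  then show ?thesis
    using graph_nat_edge by (auto simp: tree_def connected_graph_def is_cycle_def)
qed

lemma elementary_nat_edge: "elementary_graph nat_edge"
proof -
  have "bij_betw (\<lambda>a\<in>{0, 1}. a = (0 :: nat)) {0, 1} UNIV"
    by (intro bij_betwI[where g = "\<lambda>b. if b then 0 else 1"]) auto
  moreover have "graph edge_graph" by (auto simp: graph_def edge_graph_def)
  ultimately have "graph_iso nat_edge edge_graph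
      \<lparr>amap = \<lambda>a\<in>{0, 1}. a = 0, vmap = \<lambda>_. undefined\<rparr>"
    using graph_nat_edge
    by (auto simp: graph_iso_def etale_def) (auto simp: edge_graph_def bij_betw_def)
  then show ?thesis by (auto simp: elementary_graph_def isomorphic_def)
qed

text \<open>Arc 0 goes to \<open>a\<close>, so a rooting pulled back to the edge and read at 0
  returns the sign of \<open>a\<close>. The edge has no vertices, which leaves \<open>gvert\<close>
  at its extensional default.\<close>

definition edge_inclusion :: "ngraph \<Rightarrow> nat \<Rightarrow> graphical" where
  "edge_inclusion G a =
     \<lparr>garc = restrict (\<lambda>i. if i = 0 then a else dag G a) {0, 1}, gvert = (\<lambda>_. undefined)\<rparr>"

lemma edge_inclusion_simps [simp]:
  "garc (edge_inclusion G a) 0 = a" "garc (edge_inclusion G a) (Suc 0) = dag G a"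
  by (auto simp: edge_inclusion_def)

lemma edge_inclusion_inert:
  assumes G: "connected_graph G" and a: "a \<in> arcs G"
  shows "graphical_map nat_edge G (edge_inclusion G a)"
    "inert_map nat_edge G (edge_inclusion G a)"
proof -
  have "graph G" using G by (simp add: connected_graph_def)
  note g = graphD[OF this]
  have E: "connected_graph nat_edge" using tree_nat_edge by (simp add: tree_def)
  show "graphical_map nat_edge G (edge_inclusion G a)"
    using G E a g(3,4) by (auto simp: graphical_map_def edge_inclusion_def disjoint_family_on_def)
  let ?f = "\<lparr>amap = garc (edge_inclusion G a), vmap = \<lambda>_. undefined\<rparr>"
  have "embedding nat_edge G ?f"
    using G E a g(3,4) \<open>graph G\<close> graph_nat_edge
    by (auto simp: embedding_def etale_def edge_inclusion_def)
  moreover have "edge_inclusion G a = graphical_of_embedding nat_edge G ?f"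
    by (simp add: graphical_of_embedding_def edge_inclusion_def restrict_def)
  ultimately show "inert_map nat_edge G (edge_inclusion G a)" unfolding inert_map_def by blast
qed

text \<open>Makes an edge of \<open>W\<close> an inert map over \<open>T\<close>, so that signs
  found on an elementary \<open>W\<close> can be compared with those found on the edges of
  \<open>T\<close>.\<close>

lemma edge_inclusion_comp:
  assumes "graphical_map W T \<phi>" "a \<in> arcs W"
  shows "graphical_comp nat_edge W T \<phi> (edge_inclusion W a) = edge_inclusion T (garc \<phi> a)"
  using graphical_mapD(3)[OF assms]
  by (auto simp: graphical_comp_def edge_inclusion_def compose_def intro!: ext)

lemma nat_star_simps [simp]:
  "arcs (nat_star n) = {1..2 * n}" "verts (nat_star n) = {0}" "darcs (nat_star n) = {1..n}"
  "a \<in> {1..n} \<Longrightarrow> dag (nat_star n) a = a + n"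
  "a \<in> {n<..2 * n} \<Longrightarrow> dag (nat_star n) a = a - n"
  "a \<in> {1..n} \<Longrightarrow> tgt (nat_star n) a = 0"
  "boundary (nat_star n) = {n<..2 * n}" "nb (nat_star n) 0 = {1..n}"
  by (auto simp: nat_star_def boundary_def nb_def)

lemma graph_nat_star: "graph (nat_star n)"
  by (auto simp: graph_def nat_star_def)

lemma splits_sym:
  assumes "splits G A1 V1 A2 V2"
  shows "splits G A2 V2 A1 V1"
  using assms unfolding splits_def by (metis Int_commute Un_commute)

lemma tree_nat_star: "tree (nat_star n)"
proof -
  \<comment> \<open>The side without the vertex contains no arc of \<open>darcs\<close>, yet it is
    closed under the dagger and every arc or its dagger lies in \<open>darcs\<close>.\<close>
  have one_side: False if S: "splits (nat_star n) A1 V1 A2 V2" and "0 \<in> V1" for A1 V1 A2 V2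
  proof -
    have V: "{0} = V1 \<union> V2" "V1 \<inter> V2 = {}" "A2 \<noteq> {} \<or> V2 \<noteq> {}"
      and A: "{1..2 * n} = A1 \<union> A2" "dag (nat_star n) ` A2 \<subseteq> A2"
      and tgt: "tgt (nat_star n) ` ({1..n} \<inter> A2) \<subseteq> V2"
      using S unfolding splits_def nat_star_simps(1-3) by - (elim conjE, assumption)+
    have "v \<notin> V2" for v
    proof
      assume "v \<in> V2"
      then have "v \<in> {0}" unfolding V(1) by simp
      then show False using V(2) \<open>0 \<in> V1\<close> \<open>v \<in> V2\<close> by blast
    qed
    then have V2: "V2 = {}" by blast
    then have dis: "{1..n} \<inter> A2 = {}" using tgt by simp
    obtain a where a: "a \<in> A2" using V2 V(3) by blast
    then have "a \<in> {1..2 * n}" unfolding A(1) by simp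
    moreover have "dag (nat_star n) a \<in> A2" "a \<notin> {1..n}" using a A(2) dis by blast+
    moreover from calculation have "a \<in> {n<..2 * n}" by auto
    ultimately have "a - n \<in> {1..n} \<inter> A2" by auto
    then show False using dis by blast
  qed
  have "\<not> splits (nat_star n) A1 V1 A2 V2" for A1 V1 A2 V2
  proof
    assume S: "splits (nat_star n) A1 V1 A2 V2"
    then have "{0} = V1 \<union> V2" unfolding splits_def nat_star_simps(2) by (elim conjE)
    then have "0 \<in> V1 \<union> V2" by (metis singletonI)
    then show False using one_side[OF S] one_side[OF splits_sym[OF S]] by blast
  qed
  \<comment> \<open>A cycle consists of internal edges, and a star has none.\<close>
  moreover have "\<not> is_cycle (nat_star n) as" for as
  proof
    assume "is_cycle (nat_star n) as"
    then have "hd as \<in> darcs (nat_star n)" "dag (nat_star n) (hd as) \<in> darcs (nat_star n)"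
      unfolding is_cycle_def using hd_in_set by blast+
    then show False by auto
  qed
  ultimately show ?thesis
    using graph_nat_star by (simp add: tree_def connected_graph_def)
qed

definition star_labelling :: "nat \<Rightarrow> (nat \<Rightarrow> 'd) \<Rightarrow> 'v \<Rightarrow> (nat, nat, 'd + 'd, 'v) gmap" where
  "star_labelling n \<beta> v =
     \<lparr>amap = restrict (\<lambda>a. if a \<le> n then Inl (\<beta> a) else Inr (\<beta> (a - n))) {1..2 * n},
      vmap = restrict (\<lambda>_. v) {0}\<rparr>"

lemma graph_star_on: "finite N \<Longrightarrow> graph (star_on N v)"
  by (auto simp: graph_def star_on_def)

lemma star_on_simps [simp]:
  "arcs (star_on N v) = N <+> N" "verts (star_on N v) = {v}" "darcs (star_on N v) = Inl ` N"
  "d \<in> N \<Longrightarrow> dag (star_on N v) (Inl d) = Inr d"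
  "d \<in> N \<Longrightarrow> dag (star_on N v) (Inr d) = Inl d"
  "d \<in> N \<Longrightarrow> tgt (star_on N v) (Inl d) = v" "nb (star_on N v) v = Inl ` N"
  by (auto simp: nb_def star_on_def)

lemma star_labelling_iso:
  assumes \<beta>: "bij_betw \<beta> {1..n} N"
  shows "graph_iso (nat_star n) (star_on N v) (star_labelling n \<beta> v)"
proof -
  let ?z = "star_labelling n \<beta> v"
  have N: "finite N" using \<beta> bij_betw_finite by blast
  have \<beta>N: "\<beta> a \<in> N" if "a \<in> {1..n}" for a using \<beta> that by (auto simp: bij_betw_def)
  have \<beta>N': "\<beta> (a - n) \<in> N" if "\<not> a \<le> n" "a \<le> 2 * n" for a using that by (intro \<beta>N) auto
  have D: "bij_betw (amap ?z) {1..n} (Inl ` N)"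
  proof -
    have "bij_betw (Inl \<circ> \<beta>) {1..n} (Inl ` N)"
      using \<beta> by (rule bij_betw_trans) (simp add: bij_betw_def)
    then show ?thesis
      by (rule bij_betw_cong[THEN iffD1, rotated]) (auto simp: star_labelling_def)
  qed
  have B: "bij_betw (amap ?z) {n<..2 * n} (Inr ` N)"
  proof -
    have "bij_betw (\<lambda>a. a - n) {n<..2 * n} {1..n}"
      by (intro bij_betwI[where g = "\<lambda>a. a + n"]) auto
    from bij_betw_trans[OF this \<beta>] have "bij_betw (Inr \<circ> (\<beta> \<circ> (\<lambda>a. a - n))) {n<..2 * n} (Inr ` N)"
      by (rule bij_betw_trans) (simp add: bij_betw_def)
    then show ?thesis
      by (rule bij_betw_cong[THEN iffD1, rotated]) (auto simp: star_labelling_def)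
  qed
  have "{1..2 * n} = {1..n} \<union> {n<..2 * n}" by auto
  then have A: "bij_betw (amap ?z) {1..2 * n} (N <+> N)"
    using bij_betw_combine[OF D B] by (auto simp: Plus_def)
  have "amap ?z (dag (nat_star n) a) = dag (star_on N v) (amap ?z a)" if "a \<in> {1..2 * n}" for a
    using that \<beta>N by (cases "a \<le> n") (auto simp: star_labelling_def \<beta>N')
  moreover have "amap ?z \<in> {1..2 * n} \<rightarrow>\<^sub>E N <+> N"
    using \<beta>N \<beta>N' by (auto simp: star_labelling_def)
  moreover have "tgt (star_on N v) (amap ?z d) = v" "amap ?z d \<in> Inl ` N" if "d \<in> {1..n}" for d
    using that \<beta>N by (auto simp: star_labelling_def)
  ultimately have "etale (nat_star n) (star_on N v) ?z"
    using graph_nat_star graph_star_on[OF N] D unfolding etale_def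
    by (simp add: star_labelling_def[of n \<beta> v, THEN arg_cong[where f = vmap]])
  then show ?thesis
    using A D unfolding graph_iso_def by (simp add: bij_betw_def star_labelling_def[of n \<beta> v, THEN arg_cong[where f = vmap]])
qed

lemma elementary_nat_star: "elementary_graph (nat_star n)"
  using star_labelling_iso[of id n "{1..n}" "()"]
  by (auto simp: elementary_graph_def isomorphic_def star_def)

section \<open>Composites, inverses and change of domain\<close>

lemma etale_comp:
  assumes f: "etale K H f" and g: "etale H G g"
  shows "etale K G (gmap_comp K g f)"
proof -
  note f' = etaleD[OF f] and g' = etaleD[OF g]
  have nb: "nb K v \<subseteq> arcs K" for v using graphD(6)[OF f'(1)] by (auto simp: nb_def)
  have "bij_betw (compose (arcs K) (amap g) (amap f)) (nb K v) (nb G (vmap g (vmap f v)))"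
    if "v \<in> verts K" for v
  proof -
    have "bij_betw (amap g \<circ> amap f) (nb K v) (nb G (vmap g (vmap f v)))"
      using f'(10)[OF that] g'(10)[OF f'(6)[OF that]] by (rule bij_betw_trans)
    then show ?thesis
      by (rule bij_betw_cong[THEN iffD1, rotated]) (use nb in \<open>auto simp: compose_def\<close>)
  qed
  then show ?thesis
    using f' g' graphD[OF f'(1)] unfolding etale_def gmap_comp_def
    by (auto simp: compose_def PiE_iff)
qed

lemma graph_iso_comp:
  assumes z: "graph_iso K H z" and y: "graph_iso H L y"
  shows "graph_iso K L (gmap_comp K y z)"
proof -
  have "darcs K \<subseteq> arcs K" using graphD(6)[OF etaleD(1)[OF graph_isoD(1)[OF z]]] by blast
  moreover have comp: "bij_betw (compose S h g) A C"
    if "bij_betw g A B" "bij_betw h B C" "A \<subseteq> S" for S h g A B C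
    using bij_betw_trans[OF that(1,2)] that(3)
    by (subst bij_betw_cong[of _ _ "h \<circ> g"]) (auto simp: compose_def)
  ultimately show ?thesis
    using z y etale_comp[of K H z L y] unfolding graph_iso_def
    by (auto simp: gmap_comp_def intro: comp)
qed

lemma graph_iso_inverse:
  assumes z: "graph_iso K H z"
  obtains y where "graph_iso H K y" "\<And>a. a \<in> arcs H \<Longrightarrow> amap z (amap y a) = a"
    "\<And>v. v \<in> verts H \<Longrightarrow> vmap z (vmap y v) = v"
proof -
  define y where "y = \<lparr>amap = restrict (inv_into (arcs K) (amap z)) (arcs H),
    vmap = restrict (inv_into (verts K) (vmap z)) (verts H)\<rparr>"
  have b: "bij_betw (amap z) (arcs K) (arcs H)" "bij_betw (amap z) (darcs K) (darcs H)"
    "bij_betw (vmap z) (verts K) (verts H)"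
    using z by (auto simp: graph_iso_def)
  note z' = etaleD[OF graph_isoD(1)[OF z]]
  note K = graphD[OF z'(1)] and H = graphD[OF z'(2)]
  have zy: "amap z (amap y a) = a" if "a \<in> arcs H" for a
    using that b(1) by (simp add: y_def bij_betw_inv_into_right)
  have yz: "amap y (amap z a) = a" if "a \<in> arcs K" for a
    using that b(1) z'(5) by (simp add: y_def bij_betw_inv_into_left)
  have zyv: "vmap z (vmap y v) = v" if "v \<in> verts H" for v
    using that b(3) by (simp add: y_def bij_betw_inv_into_right)
  have yzv: "vmap y (vmap z v) = v" if "v \<in> verts K" for v
    using that b(3) z'(6) by (simp add: y_def bij_betw_inv_into_left)
  have y_arcs: "amap y a \<in> arcs K" if "a \<in> arcs H" for a
    using that b(1) by (simp add: y_def bij_betw_def inv_into_into)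
  have y_verts: "vmap y v \<in> verts K" if "v \<in> verts H" for v
    using that b(3) by (simp add: y_def bij_betw_def inv_into_into)
  have y_darcs: "amap y d \<in> darcs K" if "d \<in> darcs H" for d
  proof -
    obtain d' where "d' \<in> darcs K" "d = amap z d'" using \<open>d \<in> darcs H\<close> b(2) by (auto simp: bij_betw_def)
    then show ?thesis using yz K(6) by simp
  qed
  have y_tgt: "tgt K (amap y d) = vmap y (tgt H d)" if "d \<in> darcs H" for d
  proof -
    have "tgt H d = vmap z (tgt K (amap y d))"
      using z'(9)[OF y_darcs[OF that]] zy[OF H(6)[OF that]] by simp
    then show ?thesis using yzv K(7) y_darcs[OF that] by simp
  qed
  have y_dag: "amap y (dag H a) = dag K (amap y a)" if "a \<in> arcs H" for a
    using that z'(7)[OF y_arcs[OF that]] zy yz[of "dag K (amap y a)"] K(3) y_arcs by simp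
  have inv: "bij_betw (amap y) B A"
    if A: "A \<subseteq> arcs K" "B \<subseteq> arcs H" and "bij_betw (amap z) A B" for A B
  proof (rule bij_betwI[where g = "amap z"])
    show "amap z \<in> A \<rightarrow> B" using that by (auto simp: bij_betw_def)
    show "amap y \<in> B \<rightarrow> A" using that yz by (auto simp: bij_betw_def)
  qed (use that zy yz in auto)
  have y_nb: "bij_betw (amap y) (nb H v) (nb K (vmap y v))" if "v \<in> verts H" for v
    using inv[OF _ _ z'(10)[OF y_verts[OF that]]] zyv[OF that] K(6) H(6)
    by (auto simp: nb_def)
  have "bij_betw (vmap y) (verts H) (verts K)"
    by (rule bij_betwI[where g = "vmap z"]) (use y_verts z'(6) zyv yzv in auto)
  moreover have "darcs K \<subseteq> arcs K" "darcs H \<subseteq> arcs H" using K(6) H(6) by auto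
  moreover have "amap y \<in> arcs H \<rightarrow>\<^sub>E arcs K" "vmap y \<in> verts H \<rightarrow>\<^sub>E verts K"
    using y_arcs y_verts by (auto simp: y_def)
  ultimately have "graph_iso H K y"
    using inv b z'(1,2) y_dag y_darcs y_tgt y_nb
    unfolding graph_iso_def etale_def by auto
  then show thesis using that zy zyv by blast
qed

text \<open>\<open>vertex_class\<close> is named by a star with sum-type arcs, while members of
  \<open>Emb\<close> are named by graphs on natural numbers. The change of domain shows that vertex
  classes belong to \<open>Emb\<close>.\<close>

lemma emb_class_reparametrize:
  assumes z: "graph_iso K H z"
  shows "emb_class K (gmap_comp K f z) = emb_class H f"
proof -
  obtain y where y: "graph_iso H K y" "\<And>a. a \<in> arcs H \<Longrightarrow> amap z (amap y a) = a"
    "\<And>v. v \<in> verts H \<Longrightarrow> vmap z (vmap y v) = v"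
    using graph_iso_inverse[OF z] by blast
  have assoc: "gmap_comp L (gmap_comp K f z) u = gmap_comp L f (gmap_comp L z u)"
    if "graph_iso L K u" for L :: ngraph and u
    using etaleD(5,6)[OF graph_isoD(1)[OF that]]
    by (auto simp: gmap_comp_def compose_def intro!: restrict_ext)
  have unwind: "gmap_comp L (gmap_comp K f z) (gmap_comp L y u) = gmap_comp L f u"
    if "graph_iso L H u" for L :: ngraph and u
    using etaleD(5,6)[OF graph_isoD(1)[OF that]] y(2,3) etaleD(5,6)[OF graph_isoD(1)[OF y(1)]]
    by (auto simp: gmap_comp_def compose_def intro!: restrict_ext)
  show ?thesis
  proof
    show "emb_class K (gmap_comp K f z) \<subseteq> emb_class H f"
      using assoc graph_iso_comp[OF _ z] by (fastforce simp: emb_class_def)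
    show "emb_class H f \<subseteq> emb_class K (gmap_comp K f z)"
      using unwind[symmetric] graph_iso_comp[OF _ y(1)] by (fastforce simp: emb_class_def)
  qed
qed

lemma iota_etale:
  assumes G: "graph G" and v: "v \<in> verts G"
  shows "etale (star_on (nb G v) v) G (iota G v)"
proof -
  note g = graphD[OF G]
  have N: "d \<in> arcs G \<and> d \<in> darcs G \<and> tgt G d = v" if "d \<in> nb G v" for d
    using that g(6) by (simp add: nb_def)
  have "finite (nb G v)" using g(1,6) by (auto simp: nb_def intro: rev_finite_subset)
  then have "graph (star_on (nb G v) v)" by (rule graph_star_on)
  moreover have "bij_betw (amap (iota G v)) (Inl ` nb G v) (nb G v)"
    by (intro bij_betwI[where g = Inl]) (auto simp: iota_def)
  ultimately show ?thesis
    using G N g(3,4) v unfolding etale_def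
    by (auto simp: star_on_def iota_def nb_def[of "\<lparr>arcs = _, verts = _, dag = _, darcs = _, tgt = _\<rparr>"])
qed

text \<open>An isolated vertex would split off. This keeps the star at a vertex inside
  \<open>U_cyc\<close>, since the 0-star has empty boundary.\<close>

lemma connected_nb_nonempty:
  assumes G: "connected_graph G" and v: "v \<in> verts G" and ne: "arcs G \<noteq> {}"
  shows "nb G v \<noteq> {}"
proof
  assume "nb G v = {}"
  moreover have "graph G" using G by (simp add: connected_graph_def)
  ultimately have "splits G {} {v} (arcs G) (verts G - {v})"
    using v ne graphD(3,7)[of G] by (auto simp: splits_def nb_def)
  then show False using G by (simp add: connected_graph_def)
qed

section \<open>Edges and stars of a tree as elementary objects over it\<close>

lemma el_over_U_cyc [simp]:
  "(W, \<phi>) \<in> el_over U_cyc T \<longleftrightarrow> tree W \<and> boundary W \<noteq> {} \<and> elementary_graph W \<and>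
     graphical_map W T \<phi> \<and> inert_map W T \<phi>"
  by (auto simp: el_over_def U_cyc_def)

lemma edge_inclusion_el:
  "tree T \<Longrightarrow> a \<in> arcs T \<Longrightarrow> (nat_edge, edge_inclusion T a) \<in> el_over U_cyc T"
  using edge_inclusion_inert[of T a] tree_nat_edge elementary_nat_edge by (simp add: tree_def)

text \<open>Provides an elementary object that sees all of \<open>nb T v\<close>; the output
  condition at \<open>v\<close> is tested on it.\<close>

lemma star_inclusion_el:
  assumes T: "tree T" and bd: "boundary T \<noteq> {}" and v: "v \<in> verts T"
  obtains W \<phi> u where "(W, \<phi>) \<in> el_over U_cyc T" "u \<in> verts W" "bij_betw (garc \<phi>) (nb W u) (nb T v)"
proof -
  have conn: "connected_graph T" and G: "graph T" using T by (auto simp: tree_def connected_graph_def)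
  note g = graphD[OF G]
  have nb: "d \<in> arcs T" if "d \<in> nb T v" for d using that g(6) by (simp add: nb_def)
  have "finite (nb T v)" using g(1) nb by (auto intro: rev_finite_subset)
  moreover define n where "n = card (nb T v)"
  ultimately obtain \<beta> where \<beta>: "bij_betw \<beta> {1..n} (nb T v)"
    using ex_bij_betw_nat_finite_1 by blast
  have "arcs T \<noteq> {}" using bd by (auto simp: boundary_def)
  then have "nb T v \<noteq> {}" using connected_nb_nonempty[OF conn v] by blast
  then have n: "n > 0" using \<open>finite (nb T v)\<close> by (simp add: n_def card_gt_0_iff)
  let ?W = "nat_star n" and ?z = "star_labelling n \<beta> v"
  have z: "graph_iso ?W (star_on (nb T v) v) ?z" using star_labelling_iso[OF \<beta>] .
  define f where "f = gmap_comp ?W (iota T v) ?z"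
  have f: "etale ?W T f"
    unfolding f_def using etale_comp[OF graph_isoD(1)[OF z] iota_etale[OF G v]] .
  have conn_W: "connected_graph ?W" using tree_nat_star by (simp add: tree_def)
  have emb: "embedding ?W T f" using f conn conn_W by (simp add: embedding_def)
  have f0: "vmap f 0 = v"
    by (simp add: f_def gmap_comp_def iota_def star_labelling_def compose_def)
  have vc: "vertex_class T v = emb_class ?W f"
    unfolding vertex_class_def f_def using emb_class_reparametrize[OF z] by simp
  have bd_class: "emb_boundary (vertex_class T v) = amap f ` {n<..2 * n}"
    unfolding vc using emb_class_boundary emb_class_self[OF f] by fastforce
  let ?\<phi> = "graphical_of_embedding ?W T f"
  have f_nb: "bij_betw (amap f) {1..n} (nb T v)"
    using etaleD(10)[OF f, of 0] f0 by simp
  \<comment> \<open>Injectivity of \<open>f\<close> is known on the neighbourhood only; applying the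
    dagger of \<open>T\<close> moves it to the boundary arcs.\<close>
  have "bij_betw (\<lambda>a. amap f (dag ?W a)) {1..n} (amap f ` {n<..2 * n})"
    unfolding bij_betw_def
  proof
    have f_dag: "amap f (dag ?W a) = dag T (amap f a)" if "a \<in> {1..n}" for a
      using etaleD(7)[OF f, of a] that by simp
    show "inj_on (\<lambda>a. amap f (dag ?W a)) {1..n}"
    proof (rule inj_onI)
      fix a b assume ab: "a \<in> {1..n}" "b \<in> {1..n}" "amap f (dag ?W a) = amap f (dag ?W b)"
      have "amap f a \<in> nb T v" "amap f b \<in> nb T v"
        using f_nb ab by (auto simp: bij_betw_def)
      then have "amap f a = amap f b" using ab f_dag g(4) nb by metis
      then show "a = b" using f_nb ab by (auto simp: bij_betw_def dest: inj_onD)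
    qed
    have "dag ?W ` {1..n} = {n<..2 * n}"
    proof
      show "{n<..2 * n} \<subseteq> dag ?W ` {1..n}"
      proof
        fix b assume "b \<in> {n<..2 * n}"
        then have b: "b - n \<in> {1..n}" "b - n + n = b" by auto
        then have "b = dag ?W (b - n)" by (simp only: nat_star_simps(4))
        then show "b \<in> dag ?W ` {1..n}" using b(1) by (rule image_eqI)
      qed
    qed auto
    then show "(\<lambda>a. amap f (dag ?W a)) ` {1..n} = amap f ` {n<..2 * n}"
      by (metis image_image)
  qed
  then have "bij_betw (\<lambda>a. garc ?\<phi> (dag ?W a)) (nb ?W 0) (emb_boundary (gvert ?\<phi> 0))"
    by (simp add: graphical_of_embedding_def f0 bd_class)
  moreover have "vertex_class T v \<in> Emb T"
    unfolding vc Emb_def using emb by blast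
  ultimately have "graphical_map ?W T ?\<phi>"
    using conn conn_W etaleD(3,7)[OF f] n f0 unfolding graphical_map_def
    by (auto simp: graphical_of_embedding_def disjoint_family_on_def)
  then have "(?W, ?\<phi>) \<in> el_over U_cyc T"
    using n emb tree_nat_star elementary_nat_star by (auto simp: inert_map_def)
  moreover have "bij_betw (garc ?\<phi>) (nb ?W 0) (nb T v)"
    using f_nb by (simp add: graphical_of_embedding_def)
  ultimately show thesis using that[of ?W ?\<phi> 0] by simp
qed

section \<open>The Segal condition\<close>

text \<open>The rooting of an elementary object over \<open>(T, x)\<close> is forced by
  \<open>Omega_hom_iff\<close>, and the forced one always exists by
  \<open>rooted_tree_pull\<close>.\<close>

lemma el_over_Omega:
  assumes "rooted_tree (T, x)"
  shows "((W, y), \<phi>) \<in> el_over Omega (T, x) \<longleftrightarrow>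
    (W, \<phi>) \<in> el_over U_cyc T \<and> y = pull_rooting W \<phi> x"
proof
  assume L: "((W, y), \<phi>) \<in> el_over Omega (T, x)"
  then have "rooted_tree (W, y)" "\<phi> \<in> hom Omega (W, y) (T, x)" "inert_map W T \<phi>"
    "elementary_graph W"
    by (auto simp: el_over_def Omega_def)
  then show "(W, \<phi>) \<in> el_over U_cyc T \<and> y = pull_rooting W \<phi> x"
    using forget_ob[of W y] by (simp add: Omega_hom_iff)
next
  assume R: "(W, \<phi>) \<in> el_over U_cyc T \<and> y = pull_rooting W \<phi> x"
  then have "(W, y) \<in> ob Omega" "\<phi> \<in> hom Omega (W, y) (T, x)"
    using Omega_hom_pull[of W T \<phi> x] assms by auto
  moreover have "elementary_graph W" "inert_map W T \<phi>" using R by simp_all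
  ultimately show "((W, y), \<phi>) \<in> el_over Omega (T, x)"
    by (simp add: el_over_def Omega_def)
qed

lemma el_limitD:
  assumes "s \<in> el_limit C Z c"
  shows "\<And>w i. (w, i) \<in> el_over C c \<Longrightarrow> s (w, i) \<in> pob Z w"
    "\<And>w i w' i' h. (w, i) \<in> el_over C c \<Longrightarrow> (w', i') \<in> el_over C c \<Longrightarrow> h \<in> inert C w w' \<Longrightarrow>
      cmp C w w' c i' h = i \<Longrightarrow> pact Z w w' h (s (w', i')) = s (w, i)"
    "\<And>p. p \<notin> el_over C c \<Longrightarrow> s p = undefined"
  using assms unfolding el_limit_def by (fastforce simp: PiE_iff extensional_def)+

lemma el_limitI:
  assumes "\<And>w i. (w, i) \<in> el_over C c \<Longrightarrow> s (w, i) \<in> pob Z w"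
    "\<And>w i w' i' h. (w, i) \<in> el_over C c \<Longrightarrow> (w', i') \<in> el_over C c \<Longrightarrow> h \<in> inert C w w' \<Longrightarrow>
      cmp C w w' c i' h = i \<Longrightarrow> pact Z w w' h (s (w', i')) = s (w, i)"
    "\<And>p. p \<notin> el_over C c \<Longrightarrow> s p = undefined"
  shows "s \<in> el_limit C Z c"
  using assms unfolding el_limit_def by (auto simp: PiE_iff extensional_def)

lemma inert_U_cyc [simp]:
  "\<phi> \<in> inert U_cyc W W' \<longleftrightarrow> graphical_map W W' \<phi> \<and> inert_map W W' \<phi>"
  by (simp add: U_cyc_def)

lemma cmp_U_cyc [simp]: "cmp U_cyc = graphical_comp"
  by (simp add: U_cyc_def)

text \<open>The sign values and their reversal are visible on a single edge, and the output
  condition on a single star.\<close>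

lemma rooted_tree_glue:
  assumes T: "tree T" and bd: "boundary T \<noteq> {}" and x: "x \<in> extensional (arcs T)"
    and local: "\<And>W \<phi>. (W, \<phi>) \<in> el_over U_cyc T \<Longrightarrow> rooted_tree (W, pull_rooting W \<phi> x)"
  shows "rooted_tree (T, x)"
proof -
  have G: "graph T" using T by (simp add: tree_def connected_graph_def)
  have edge: "x a \<in> {1, -1} \<and> x (dag T a) = - x a" if a: "a \<in> arcs T" for a
  proof -
    have R: "rooted_tree (nat_edge, pull_rooting nat_edge (edge_inclusion T a) x)"
      using local edge_inclusion_el[OF T a] by blast
    show ?thesis
      using rooted_tree_val[OF R, of 0] rooted_treeD(5)[OF R, of 0] by (simp add: pull_rooting_def)
  qed
  have "\<exists>!d. d \<in> nb T v \<and> x d = 1" if v: "v \<in> verts T" for v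
  proof -
    obtain W \<phi> u where W: "(W, \<phi>) \<in> el_over U_cyc T" and u: "u \<in> verts W"
      and bij: "bij_betw (garc \<phi>) (nb W u) (nb T v)"
      using star_inclusion_el[OF T bd v] by blast
    note R = local[OF W]
    have "d \<in> arcs W" if "d \<in> nb W u" for d
      using that graphD(6)[OF rooted_treeD(3)[OF R]] by (simp add: nb_def)
    then have "pull_rooting W \<phi> x d = x (garc \<phi> d)" if "d \<in> nb W u" for d
      using that by (simp add: pull_rooting_def)
    then show ?thesis
      using rooted_treeD(6)[OF R u] unfolding bij_betw_Ex1_iff[OF bij] by (metis (no_types, lifting))
  qed
  then show ?thesis using T edge x by (auto simp: rooted_tree_def PiE_iff)
qed

text \<open>Joint injectivity of \<open>\<eta>\<close> over an elementary \<open>W\<close> splits an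
  equation of sections into one of rootings and one in \<open>X\<close>. Both injectivity and
  surjectivity settle the rooting first and then use the Segal condition of \<open>X\<close> at
  \<open>(T, x)\<close>.\<close>

lemma fibrewise_extension_segal:
  assumes X: "segal Omega X" and F: "fibrewise_extension X Y \<eta>"
  shows "segal U_cyc Y"
proof -
  note Y = fibrewise_extensionD[OF F]
  have XP: "presheaf Omega X" using X by (simp add: segal_def)
  have "bij_betw (\<lambda>z. \<lambda>(W, \<phi>)\<in>el_over U_cyc T. pact Y W T \<phi> z) (pob Y T) (el_limit U_cyc Y T)"
    if T: "T \<in> ob U_cyc" for T
  proof -
    define res where "res z = (\<lambda>(W, \<phi>)\<in>el_over U_cyc T. pact Y W T \<phi> z)" for z
    have res: "res z (W, \<phi>) = pact Y W T \<phi> z" if "(W, \<phi>) \<in> el_over U_cyc T" for z W \<phi>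
      using that unfolding res_def by (simp del: el_over_U_cyc)
    have tree_T: "tree T" "boundary T \<noteq> {}" using T by auto
    have E: "W \<in> ob U_cyc" "graphical_map W T \<phi>" "tree W" if "(W, \<phi>) \<in> el_over U_cyc T" for W \<phi>
      using that by auto
    have "res y \<in> el_limit U_cyc Y T" if y: "y \<in> pob Y T" for y
    proof (rule el_limitI)
      fix W \<phi> assume W: "(W, \<phi>) \<in> el_over U_cyc T"
      show "res y (W, \<phi>) \<in> pob Y W"
        unfolding res[OF W] using presheafD(1)[OF Y(1) E(1)[OF W] T _ y] E(2)[OF W] by simp
    next
      fix W \<phi> W' \<phi>' h
      assume W: "(W, \<phi>) \<in> el_over U_cyc T" and W': "(W', \<phi>') \<in> el_over U_cyc T"
        and h: "h \<in> inert U_cyc W W'" and c: "cmp U_cyc W W' T \<phi>' h = \<phi>"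
      show "pact Y W W' h (res y (W', \<phi>')) = res y (W, \<phi>)"
        unfolding res[OF W] res[OF W'] unfolding c[symmetric]
        using presheafD(3)[OF Y(1) E(1)[OF W] E(1)[OF W'] T _ _ y] h E(2)[OF W'] by simp
    qed (auto simp: res_def simp del: el_over_U_cyc)
    moreover have "inj_on res (pob Y T)"
    proof (rule inj_onI)
      fix y y' assume y: "y \<in> pob Y T" "y' \<in> pob Y T" and eq: "res y = res y'"
      obtain x z where R: "rooted_tree (T, x)" and z: "z \<in> pob X (T, x)" and yz: "y = \<eta> (T, x) z"
        using Y(5)[OF T y(1)] by blast
      obtain x' z' where R': "rooted_tree (T, x')" and z': "z' \<in> pob X (T, x')"
        and yz': "y' = \<eta> (T, x') z'"
        using Y(5)[OF T y(2)] by blast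
      have local: "pull_rooting W \<phi> x = pull_rooting W \<phi> x' \<and>
          pact X (W, pull_rooting W \<phi> x) (T, x) \<phi> z = pact X (W, pull_rooting W \<phi> x') (T, x') \<phi> z'"
        if W: "(W, \<phi>) \<in> el_over U_cyc T" for W \<phi>
      proof -
        note h = Omega_hom_pull[OF E(2,3)[OF W] R] and h' = Omega_hom_pull[OF E(2,3)[OF W] R']
        have "pact X (W, pull_rooting W \<phi> x) (T, x) \<phi> z \<in> pob X (W, pull_rooting W \<phi> x)"
          "pact X (W, pull_rooting W \<phi> x') (T, x') \<phi> z' \<in> pob X (W, pull_rooting W \<phi> x')"
          using presheafD(1)[OF XP h(1) _ h(2) z] presheafD(1)[OF XP h'(1) _ h'(2) z'] R R'
          by simp_all
        moreover have "\<eta> (W, pull_rooting W \<phi> x) (pact X (W, pull_rooting W \<phi> x) (T, x) \<phi> z) =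
            \<eta> (W, pull_rooting W \<phi> x') (pact X (W, pull_rooting W \<phi> x') (T, x') \<phi> z')"
          using fun_cong[OF eq, of "(W, \<phi>)"] Y(6)[OF E(1,2)[OF W] R z] Y(6)[OF E(1,2)[OF W] R' z']
          unfolding res[OF W] by (simp add: yz yz')
        ultimately show ?thesis using Y(4) h(1) h'(1) by simp
      qed
      \<comment> \<open>Edges alone determine the rooting.\<close>
      have "x a = x' a" if a: "a \<in> arcs T" for a
      proof -
        have "pull_rooting nat_edge (edge_inclusion T a) x 0 =
            pull_rooting nat_edge (edge_inclusion T a) x' 0"
          using local[OF edge_inclusion_el[OF tree_T(1) a]] by simp
        then show ?thesis by (simp add: pull_rooting_def)
      qed
      then have x: "x' = x"
        using rooted_treeD(4)[OF R] rooted_treeD(4)[OF R'] by (metis PiE_ext)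
      have "(\<lambda>(w, i)\<in>el_over Omega (T, x). pact X w (T, x) i z) =
          (\<lambda>(w, i)\<in>el_over Omega (T, x). pact X w (T, x) i z')"
        using local unfolding x
        by (intro restrict_ext) (auto simp: el_over_Omega[OF R] simp del: el_over_U_cyc)
      moreover have "inj_on (\<lambda>z. \<lambda>(w, i)\<in>el_over Omega (T, x). pact X w (T, x) i z) (pob X (T, x))"
        using X R by (auto simp: segal_def bij_betw_def)
      ultimately have "z = z'" using z z' x by (auto dest: inj_onD)
      then show "y = y'" by (simp add: yz yz' x)
    qed
    moreover have "\<exists>y\<in>pob Y T. res y = s" if s: "s \<in> el_limit U_cyc Y T" for s
    proof -
      note s' = el_limitD[OF s]
      \<comment> \<open>The matching family splits into rootings \<open>r\<close> and elements
        \<open>\<zeta>\<close> of \<open>X\<close>, which are glued separately.\<close>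
      have "\<forall>W \<phi>. \<exists>x z. (W, \<phi>) \<in> el_over U_cyc T \<longrightarrow>
          rooted_tree (W, x) \<and> z \<in> pob X (W, x) \<and> s (W, \<phi>) = \<eta> (W, x) z"
        using Y(5)[OF E(1) s'(1)] by blast
      then obtain r \<zeta> where "\<forall>W \<phi>. (W, \<phi>) \<in> el_over U_cyc T \<longrightarrow> rooted_tree (W, r W \<phi>) \<and>
          \<zeta> W \<phi> \<in> pob X (W, r W \<phi>) \<and> s (W, \<phi>) = \<eta> (W, r W \<phi>) (\<zeta> W \<phi>)"
        by metis
      then have r: "\<And>W \<phi>. (W, \<phi>) \<in> el_over U_cyc T \<Longrightarrow> rooted_tree (W, r W \<phi>)"
        and \<zeta>: "\<And>W \<phi>. (W, \<phi>) \<in> el_over U_cyc T \<Longrightarrow> \<zeta> W \<phi> \<in> pob X (W, r W \<phi>)"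
        and s_eq: "\<And>W \<phi>. (W, \<phi>) \<in> el_over U_cyc T \<Longrightarrow> s (W, \<phi>) = \<eta> (W, r W \<phi>) (\<zeta> W \<phi>)"
        by blast+
      have compat: "pull_rooting W h (r W' \<phi>') = r W \<phi> \<and>
          pact X (W, r W \<phi>) (W', r W' \<phi>') h (\<zeta> W' \<phi>') = \<zeta> W \<phi>"
        if W: "(W, \<phi>) \<in> el_over U_cyc T" and W': "(W', \<phi>') \<in> el_over U_cyc T"
          and h: "graphical_map W W' h" "inert_map W W' h" "graphical_comp W W' T \<phi>' h = \<phi>"
        for W \<phi> W' \<phi>' h
      proof -
        note H = Omega_hom_pull[OF h(1) E(3)[OF W] r[OF W']]
        have "pact Y W W' h (s (W', \<phi>')) = s (W, \<phi>)" using s'(2)[OF W W'] h by simp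
        then have "\<eta> (W, pull_rooting W h (r W' \<phi>'))
            (pact X (W, pull_rooting W h (r W' \<phi>')) (W', r W' \<phi>') h (\<zeta> W' \<phi>')) =
            \<eta> (W, r W \<phi>) (\<zeta> W \<phi>)"
          using Y(6)[OF E(1)[OF W] h(1) r[OF W'] \<zeta>[OF W']] s_eq[OF W] s_eq[OF W'] by simp
        moreover have "pact X (W, pull_rooting W h (r W' \<phi>')) (W', r W' \<phi>') h (\<zeta> W' \<phi>')
            \<in> pob X (W, pull_rooting W h (r W' \<phi>'))"
          using presheafD(1)[OF XP H(1) _ H(2) \<zeta>[OF W']] r[OF W'] by simp
        ultimately have "pull_rooting W h (r W' \<phi>') = r W \<phi> \<and>
            pact X (W, pull_rooting W h (r W' \<phi>')) (W', r W' \<phi>') h (\<zeta> W' \<phi>') = \<zeta> W \<phi>"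
          using Y(4) H(1) r[OF W] \<zeta>[OF W] by simp
        then show ?thesis by auto
      qed
      \<comment> \<open>The global sign of \<open>a\<close> is the local sign at arc 0, the arc that
        \<open>edge_inclusion T a\<close> sends to \<open>a\<close>.\<close>
      define x where "x = (\<lambda>a\<in>arcs T. r nat_edge (edge_inclusion T a) 0)"
      have pull_x: "pull_rooting W \<phi> x = r W \<phi>" if W: "(W, \<phi>) \<in> el_over U_cyc T" for W \<phi>
      proof
        fix b
        show "pull_rooting W \<phi> x b = r W \<phi> b"
        proof (cases "b \<in> arcs W")
          case True
          have "connected_graph W" using E(3)[OF W] by (simp add: tree_def)
          note i = edge_inclusion_inert[OF this True]
          have arc: "garc \<phi> b \<in> arcs T" using graphical_mapD(2)[OF E(2)[OF W] True] .
          \<comment> \<open>The edge of \<open>W\<close> at \<open>b\<close> followed by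
            \<open>\<phi>\<close> is the edge of \<open>T\<close> at \<open>garc \<phi> b\<close>,
            so \<open>compat\<close> applies with this edge inclusion as connecting map.\<close>
          have "pull_rooting nat_edge (edge_inclusion W b) (r W \<phi>) =
              r nat_edge (edge_inclusion T (garc \<phi> b))"
            using compat[OF edge_inclusion_el[OF tree_T(1) arc] W i]
              edge_inclusion_comp[OF E(2)[OF W] True] by simp
          then have "r W \<phi> b = r nat_edge (edge_inclusion T (garc \<phi> b)) 0"
            by (metis (no_types, lifting) comp_apply edge_inclusion_simps(1) insertI1
                nat_edge_simps(1) pull_rooting_def restrict_apply')
          then show ?thesis using True arc by (simp add: pull_rooting_def x_def)
        next
          case False
          then show ?thesis
            using rooted_treeD(4)[OF r[OF W]] by (auto simp: pull_rooting_def PiE_iff extensional_def)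
        qed
      qed
      have R: "rooted_tree (T, x)"
        using rooted_tree_glue[OF tree_T, of x] pull_x r by (simp add: x_def del: el_over_U_cyc)
      note el = el_over_Omega[OF R]
      \<comment> \<open>By \<open>pull_x\<close> the rooting of each elementary object over
        \<open>(T, x)\<close> is the local one, so \<open>\<zeta>\<close> already takes values where
        a matching family of \<open>X\<close> needs them.\<close>
      define t where "t = (\<lambda>(S, \<phi>)\<in>el_over Omega (T, x). \<zeta> (fst S) \<phi>)"
      have t: "t ((W, r W \<phi>), \<phi>) = \<zeta> W \<phi>" if "(W, \<phi>) \<in> el_over U_cyc T" for W \<phi>
        using that pull_x[OF that] by (simp add: t_def el del: el_over_U_cyc)
      have "t \<in> el_limit Omega X (T, x)"
      proof (rule el_limitI)
        fix S \<phi> assume S: "(S, \<phi>) \<in> el_over Omega (T, x)"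
        obtain W y where [simp]: "S = (W, y)" by fastforce
        have W: "(W, \<phi>) \<in> el_over U_cyc T" and y: "y = r W \<phi>"
          using S pull_x unfolding \<open>S = (W, y)\<close> el by blast+
        show "t (S, \<phi>) \<in> pob X S" using t[OF W] \<zeta>[OF W] y by simp
      next
        fix S \<phi> S' \<phi>' h
        assume S: "(S, \<phi>) \<in> el_over Omega (T, x)" and S': "(S', \<phi>') \<in> el_over Omega (T, x)"
          and h: "h \<in> inert Omega S S'" and c: "cmp Omega S S' (T, x) \<phi>' h = \<phi>"
        obtain W y W' y' where [simp]: "S = (W, y)" "S' = (W', y')" by fastforce
        have W: "(W, \<phi>) \<in> el_over U_cyc T" "y = r W \<phi>" and W': "(W', \<phi>') \<in> el_over U_cyc T" "y' = r W' \<phi>'"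
          using S S' pull_x unfolding \<open>S = (W, y)\<close> \<open>S' = (W', y')\<close> el by blast+
        have "graphical_map W W' h" "inert_map W W' h" "graphical_comp W W' T \<phi>' h = \<phi>"
          using h c by (auto simp: Omega_def Omega_hom_def)
        then show "pact X S S' h (t (S', \<phi>')) = t (S, \<phi>)"
          using compat[OF W(1) W'(1)] t[OF W(1)] t[OF W'(1)] W(2) W'(2) by simp
      qed (simp add: t_def)
      moreover have "bij_betw (\<lambda>z. \<lambda>(w, i)\<in>el_over Omega (T, x). pact X w (T, x) i z)
          (pob X (T, x)) (el_limit Omega X (T, x))"
        using X R by (simp add: segal_def)
      ultimately obtain z where z: "z \<in> pob X (T, x)"
        and t_eq: "t = (\<lambda>(w, i)\<in>el_over Omega (T, x). pact X w (T, x) i z)"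
        by (auto simp: bij_betw_def)
      have "res (\<eta> (T, x) z) = s"
      proof
        fix q :: "ngraph \<times> graphical"
        obtain W \<phi> where q: "q = (W, \<phi>)" by fastforce
        show "res (\<eta> (T, x) z) q = s q"
        proof (cases "(W, \<phi>) \<in> el_over U_cyc T")
          case True
          have "t ((W, r W \<phi>), \<phi>) = pact X (W, r W \<phi>) (T, x) \<phi> z"
            unfolding t_eq using True pull_x[OF True] by (simp add: el del: el_over_U_cyc)
          then show ?thesis
            using Y(6)[OF E(1,2)[OF True] R z] pull_x[OF True] t[OF True] s_eq[OF True] res[OF True]
            by (simp add: q)
        next
          case False
          then show ?thesis using s'(3)[OF False] by (simp add: res_def q del: el_over_U_cyc)
        qed
      qed
      then show ?thesis using Y(3)[OF R z] by blast
    qed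
    ultimately have "bij_betw res (pob Y T) (el_limit U_cyc Y T)"
      unfolding bij_betw_def by blast
    then show ?thesis unfolding res_def .
  qed
  then show ?thesis using Y(1) by (simp add: segal_def)
qed

text \<open>Existence is a conjunct of its own so that the quantification over all left Kan
  extensions is not vacuous.\<close>

theorem proposition6p24:
  fixes X :: "(ngraph \<times> (nat \<Rightarrow> int), graphical, 's) psh"
  assumes "infinite (UNIV :: 's set)"
    and "presheaf Omega X"
  shows "(\<exists>Y \<eta>. left_Kan_extension Omega U_cyc forget X Y \<eta>) \<and>
         (segal Omega X \<longrightarrow>
            (\<forall>Y \<eta>. left_Kan_extension Omega U_cyc forget X Y \<eta> \<longrightarrow> segal U_cyc Y))"
  using fibrewise_extension_exists[OF assms] fibrewise_extension_is_Kan[OF assms(2)]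
    Kan_extension_is_fibrewise[OF assms] fibrewise_extension_segal
  by blast

end
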